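(* Assume that $C_{\phi,w}$ is a bounded operator defined on the whole of $L^2(\mu)$. Then the following conditions are equivalent: (i) $C_{\phi,w}$ is weakly centered; (ii) $C_{\phi,\,\chi_{\{h_{\phi,w}>0\}}\widetilde w}=C_{\phi,\,\widetilde w_{1/2}}$; (iii) $h_{\phi,w}=E_{\phi,w}(h_{\phi,w})$ a.e. $[\mu_w]$.
   Context: $(X,\mathscr A,\mu)$ is a $\sigma$-finite measure space, $\phi\colon X\to X$ and $w\colon X\to\mathbb C$ are $\mathscr A$-measurable, $\mu_w(\sigma)=\int_\sigma|w|^2\,d\mu$ for $\sigma\in\mathscr A$, and the measure $\mu_w\circ\phi^{-1}$, $\sigma\mapsto\mu_w(\phi^{-1}(\sigma))$, is assumed absolutely continuous with respect to $\mu$. The weighted composition operator $C_{\phi,w}$ in the complex Hilbert space $L^2(\mu)$ has domain $\{f\in L^2(\mu): w\cdot(f\circ\phi)\in L^2(\mu)\}$ and acts by $C_{\phi,w}f=w\cdot(f\circ\phi)$. The function $h_{\phi,w}\colon X\to[0,\infty]$ is the Radon-Nikodym derivative, i.e. $\mu_w(\phi^{-1}(\Delta))=\int_\Delta h_{\phi,w}\,d\mu$ for all $\Delta\in\mathscr A$. $E_{\phi,w}(f)$ denotes the conditional expectation of an $\mathscr A$-measurable $f\colon X\to[0,\infty]$ with respect to the $\sigma$-algebra $\phi^{-1}(\mathscr A)$ and the measure $\mu_w$: the (up to $\mu_w$-null sets) unique $\phi^{-1}(\mathscr A)$-measurable function with $\int_\Delta f\,d\mu_w=\int_\Delta E_{\phi,w}(f)\,d\mu_w$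 for all $\Delta\in\phi^{-1}(\mathscr A)$. A bounded operator $T$ on a Hilbert space is weakly centered if $TT^*T^*T=T^*TTT^*$. Set $\widetilde w=\dfrac{w}{\sqrt{h_{\phi,w}\circ\phi}}$, $w_{1/2}=w\cdot\Big(\dfrac{h_{\phi,w}}{h_{\phi,w}\circ\phi}\Big)^{1/4}$, and $\widetilde w_{1/2}=\dfrac{w_{1/2}}{\sqrt{h_{\phi,w_{1/2}}\circ\phi}}$, where, with $\mu_{w_{1/2}}(\sigma)=\int_\sigma|w_{1/2}|^2\,d\mu$ for $\sigma\in\mathscr A$, the function $h_{\phi,w_{1/2}}\colon X\to[0,\infty]$ is the Radon-Nikodym derivative of $\mu_{w_{1/2}}\circ\phi^{-1}$ with respect to $\mu$, i.e. $\mu_{w_{1/2}}(\phi^{-1}(\Delta))=\int_\Delta h_{\phi,w_{1/2}}\,d\mu$ for all $\Delta\in\mathscr A$. (One has $h_{\phi,w}\circ\phi>0$ a.e. $[\mu_w]$ and $h_{\phi,w_{1/2}}\circ\phi>0$ a.e. $[\mu_{w_{1/2}}]$; the quotients are understood to be $0$ where their numerators $w$, respectively $w_{1/2}$, vanish.) $\chi_S$ is the indicator function of $S$. *)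

theory Defs
  imports "HOL-Probability.Conditional_Expectation"
begin

text \<open>The Hilbert space \<open>L\<^sup>2(M)\<close> consists of classes of measurable square-integrable functions modulo
  equality almost everywhere; operators in it are partial maps on these classes, so that equality of
  operators includes equality of domains. The underlying set is \<^term>\<open>space M\<close>; values outside of it
  are irrelevant.\<close>

type_synonym 'a l2 = "('a \<Rightarrow> complex) set"

definition square_integrable :: "'a measure \<Rightarrow> ('a \<Rightarrow> complex) set" where
  "square_integrable M = {f \<in> borel_measurable M. integrable M (\<lambda>x. (cmod (f x))\<^sup>2)}"

definition ae_rel :: "'a measure \<Rightarrow> (('a \<Rightarrow> complex) \<times> ('a \<Rightarrow> complex)) set" where
  "ae_rel M = {(f, g). f \<in> square_integrable M \<and> g \<in> square_integrable M \<and> (AE x in M. f x = g x)}"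

definition L2 :: "'a measure \<Rightarrow> 'a l2 set" where
  "L2 M = square_integrable M // ae_rel M"

definition l2_class :: "'a measure \<Rightarrow> ('a \<Rightarrow> complex) \<Rightarrow> 'a l2" where
  "l2_class M f = ae_rel M `` {f}"

definition l2_rep :: "'a l2 \<Rightarrow> 'a \<Rightarrow> complex" where
  "l2_rep F = (SOME f. f \<in> F)"

definition l2_inner :: "'a measure \<Rightarrow> 'a l2 \<Rightarrow> 'a l2 \<Rightarrow> complex" where
  "l2_inner M F G = (\<integral>x. l2_rep F x * cnj (l2_rep G x) \<partial>M)"

definition l2_norm :: "'a measure \<Rightarrow> 'a l2 \<Rightarrow> real" where
  "l2_norm M F = sqrt (\<integral>x. (cmod (l2_rep F x))\<^sup>2 \<partial>M)"

definition bounded_on_L2 :: "'a measure \<Rightarrow> ('a l2 \<rightharpoonup> 'a l2) \<Rightarrow> bool" where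
  "bounded_on_L2 M T \<longleftrightarrow> dom T = L2 M \<and> ran T \<subseteq> L2 M \<and>
     (\<exists>K. \<forall>F\<in>L2 M. l2_norm M (the (T F)) \<le> K * l2_norm M F)"

text \<open>The adjoint of a densely defined operator (for which the vector \<open>K\<close> below is unique).\<close>

definition l2_adjoint :: "'a measure \<Rightarrow> ('a l2 \<rightharpoonup> 'a l2) \<Rightarrow> ('a l2 \<rightharpoonup> 'a l2)" where
  "l2_adjoint M T = (\<lambda>G.
     if G \<in> L2 M \<and> (\<exists>K\<in>L2 M. \<forall>F\<in>dom T. l2_inner M (the (T F)) G = l2_inner M F K)
     then Some (THE K. K \<in> L2 M \<and> (\<forall>F\<in>dom T. l2_inner M (the (T F)) G = l2_inner M F K))
     else None)"

text \<open>To be used for bounded operators on the whole of \<open>L\<^sup>2(M)\<close> only.\<close>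

definition weakly_centered :: "'a measure \<Rightarrow> ('a l2 \<rightharpoonup> 'a l2) \<Rightarrow> bool" where
  "weakly_centered M T \<longleftrightarrow>
     T \<circ>\<^sub>m l2_adjoint M T \<circ>\<^sub>m l2_adjoint M T \<circ>\<^sub>m T =
     l2_adjoint M T \<circ>\<^sub>m T \<circ>\<^sub>m T \<circ>\<^sub>m l2_adjoint M T"

definition weighted_measure :: "'a measure \<Rightarrow> ('a \<Rightarrow> complex) \<Rightarrow> 'a measure" where
  "weighted_measure M w = density M (\<lambda>x. ennreal ((cmod (w x))\<^sup>2))"

definition wcomp_fun :: "('a \<Rightarrow> 'a) \<Rightarrow> ('a \<Rightarrow> complex) \<Rightarrow> ('a \<Rightarrow> complex) \<Rightarrow> 'a \<Rightarrow> complex" where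
  "wcomp_fun \<phi> w f = (\<lambda>x. w x * f (\<phi> x))"

text \<open>The weighted composition operator with its maximal domain. It does not depend on the choice of
  representatives if \<open>\<mu>\<^sub>w \<circ> \<phi>\<inverse>\<close> is absolutely continuous, see \<open>wcomp_op_class\<close> below.\<close>

definition wcomp_op ::
    "'a measure \<Rightarrow> ('a \<Rightarrow> 'a) \<Rightarrow> ('a \<Rightarrow> complex) \<Rightarrow> ('a l2 \<rightharpoonup> 'a l2)" where
  "wcomp_op M \<phi> w = (\<lambda>F.
     if F \<in> L2 M \<and> wcomp_fun \<phi> w (l2_rep F) \<in> square_integrable M
     then Some (l2_class M (wcomp_fun \<phi> w (l2_rep F)))
     else None)"

definition h_deriv :: "'a measure \<Rightarrow> ('a \<Rightarrow> 'a) \<Rightarrow> ('a \<Rightarrow> complex) \<Rightarrow> 'a \<Rightarrow> ennreal" where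
  "h_deriv M \<phi> w = RN_deriv M (distr (weighted_measure M w) M \<phi>)"

definition cond_exp_w ::
    "'a measure \<Rightarrow> ('a \<Rightarrow> 'a) \<Rightarrow> ('a \<Rightarrow> complex) \<Rightarrow> ('a \<Rightarrow> ennreal) \<Rightarrow> 'a \<Rightarrow> ennreal" where
  "cond_exp_w M \<phi> w f = nn_cond_exp (weighted_measure M w) (vimage_algebra (space M) \<phi> M) f"

text \<open>In the following two definitions quotients with denominator \<open>0\<close> or \<open>\<infinity>\<close> evaluate to \<open>0\<close>. The
  value \<open>h = 0\<close> at \<open>\<phi> x\<close> only occurs on a null set of \<open>weighted_measure M w\<close>, and \<open>h = \<infinity>\<close> only on a
  null set of \<open>M\<close> if the operator is bounded.\<close>

definition w_tilde :: "'a measure \<Rightarrow> ('a \<Rightarrow> 'a) \<Rightarrow> ('a \<Rightarrow> complex) \<Rightarrow> 'a \<Rightarrow> complex" where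
  "w_tilde M \<phi> w = (\<lambda>x. w x / complex_of_real (sqrt (enn2real (h_deriv M \<phi> w (\<phi> x)))))"

definition w_half :: "'a measure \<Rightarrow> ('a \<Rightarrow> 'a) \<Rightarrow> ('a \<Rightarrow> complex) \<Rightarrow> 'a \<Rightarrow> complex" where
  "w_half M \<phi> w = (\<lambda>x. w x * complex_of_real
     ((enn2real (h_deriv M \<phi> w x) / enn2real (h_deriv M \<phi> w (\<phi> x))) powr (1 / 4)))"

lemma equiv_ae_rel: "equiv (square_integrable M) (ae_rel M)"
  by (rule equivI) (auto simp: ae_rel_def refl_on_def sym_def trans_def elim: AE_mp)

lemma l2_rep_class:
  assumes "f \<in> square_integrable M"
  shows "l2_rep (l2_class M f) \<in> square_integrable M" "AE x in M. l2_rep (l2_class M f) x = f x"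
proof -
  have "f \<in> l2_class M f"
    using assms by (simp add: l2_class_def ae_rel_def)
  then have "l2_rep (l2_class M f) \<in> l2_class M f"
    unfolding l2_rep_def by (rule someI[where P = "\<lambda>g. g \<in> l2_class M f"])
  then have *: "l2_rep (l2_class M f) \<in> square_integrable M"
    "AE x in M. f x = l2_rep (l2_class M f) x"
    by (auto simp only: l2_class_def ae_rel_def Image_singleton_iff mem_Collect_eq case_prod_conv)
  show "l2_rep (l2_class M f) \<in> square_integrable M" by fact
  show "AE x in M. l2_rep (l2_class M f) x = f x" using *(2) by eventually_elim simp
qed

lemma l2_class_eq:
  assumes "f \<in> square_integrable M" "g \<in> square_integrable M" "AE x in M. f x = g x"
  shows "l2_class M f = l2_class M g"
  unfolding l2_class_def
  using equiv_class_eq[OF equiv_ae_rel, of f g M] assms by (simp add: ae_rel_def)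

lemma square_integrable_cong:
  assumes "f \<in> square_integrable M" "g \<in> borel_measurable M" "AE x in M. f x = g x"
  shows "g \<in> square_integrable M"
proof -
  have "integrable M (\<lambda>x. (cmod (f x))\<^sup>2) = integrable M (\<lambda>x. (cmod (g x))\<^sup>2)"
    using assms by (intro integrable_cong_AE) (auto simp: square_integrable_def elim: AE_mp)
  then show ?thesis using assms by (simp add: square_integrable_def)
qed

lemma l2_inner_class:
  assumes "f \<in> square_integrable M" "g \<in> square_integrable M"
  shows "l2_inner M (l2_class M f) (l2_class M g) = (\<integral>x. f x * cnj (g x) \<partial>M)"
proof -
  note f = l2_rep_class[OF assms(1)] and g = l2_rep_class[OF assms(2)]
  have [measurable]: "f \<in> borel_measurable M" "g \<in> borel_measurable M"
    "l2_rep (l2_class M f) \<in> borel_measurable M" "l2_rep (l2_class M g) \<in> borel_measurable M"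
    using assms f(1) g(1) by (auto simp: square_integrable_def)
  have cnj: "cnj \<in> borel_measurable borel"
    by (intro borel_measurable_continuous_onI continuous_intros)
  note [measurable] = measurable_compose[OF _ cnj]
  show ?thesis unfolding l2_inner_def
    by (rule integral_cong_AE) (use f(2) g(2) in auto)
qed

lemma wcomp_op_class:
  assumes \<phi>[measurable]: "\<phi> \<in> measurable M M"
    and w[measurable]: "w \<in> borel_measurable M"
    and ac: "absolutely_continuous M (distr (weighted_measure M w) M \<phi>)"
    and f: "f \<in> square_integrable M"
  shows "wcomp_op M \<phi> w (l2_class M f) =
    (if wcomp_fun \<phi> w f \<in> square_integrable M
     then Some (l2_class M (wcomp_fun \<phi> w f)) else None)"
proof -
  define g where "g = l2_rep (l2_class M f)"
  have g: "g \<in> square_integrable M" "AE x in M. g x = f x"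
    using l2_rep_class[OF f] by (simp_all add: g_def)
  have [measurable]: "f \<in> borel_measurable M" "g \<in> borel_measurable M"
    using f g(1) by (auto simp: square_integrable_def)
  have "{x \<in> space M. g x \<noteq> f x} \<in> null_sets M"
    using g(2) by (simp add: AE_iff_null)
  then have "{x \<in> space M. g x \<noteq> f x} \<in> null_sets (distr (weighted_measure M w) M \<phi>)"
    using ac by (auto simp: absolutely_continuous_def)
  then have "AE x in distr (weighted_measure M w) M \<phi>. g x = f x"
    by (subst AE_iff_null) (auto simp: weighted_measure_def)
  then have "AE x in weighted_measure M w. g (\<phi> x) = f (\<phi> x)"
    by (subst (asm) AE_distr_iff) (auto simp: weighted_measure_def)
  then have ae: "AE x in M. wcomp_fun \<phi> w g x = wcomp_fun \<phi> w f x"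
    unfolding weighted_measure_def
    by (subst (asm) AE_density) (auto simp: wcomp_fun_def elim: AE_mp)
  have ae': "AE x in M. wcomp_fun \<phi> w f x = wcomp_fun \<phi> w g x"
    using ae by eventually_elim simp
  have meas: "wcomp_fun \<phi> w f \<in> borel_measurable M" "wcomp_fun \<phi> w g \<in> borel_measurable M"
    unfolding wcomp_fun_def by measurable
  have L2: "l2_class M f \<in> L2 M"
    using f by (simp add: L2_def l2_class_def quotientI)
  have "wcomp_fun \<phi> w g \<in> square_integrable M \<longleftrightarrow> wcomp_fun \<phi> w f \<in> square_integrable M"
    using square_integrable_cong ae ae' meas by blast
  then show ?thesis
    using L2 l2_class_eq[OF _ _ ae] by (auto simp: wcomp_op_def g_def[symmetric])
qed

end

theory Submission imports Defs begin

text \<open>Let \<open>T = C\<^bsub>\<phi>,w\<^esub>\<close> and \<open>h = h\<^bsub>\<phi>,w\<^esub>\<close>. All three conditions say the same thing about \<open>h\<close>: it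
  is a function of \<open>\<phi>\<close>, that is, \<open>h = k \<circ> \<phi>\<close> almost everywhere where \<open>w \<noteq> 0\<close>, for some measurable
  \<open>k\<close> (\<open>h_factors_through_symbol\<close>). Each of them is compared with this property separately.

  Since \<open>T\<^sup>*T\<close> is multiplication by \<open>h\<close> (\<open>is_adj_T\<close>), the operator \<open>T\<close> is weakly centered if and only
  if \<open>TT\<^sup>*\<close> commutes with multiplication by \<open>h\<close>, which means
  \<open>(T\<^sup>*(hf)) \<circ> \<phi> = h \<cdot> (T\<^sup>*f) \<circ> \<phi>\<close> on \<open>{w \<noteq> 0}\<close> for all \<open>f\<close> (\<open>weakly_centered_iff\<close>). If this holds, the
  choice \<open>f = Tg\<close> with \<open>g > 0\<close> makes \<open>T\<^sup>*f = hg\<close> nonzero at \<open>\<phi> x\<close>, and dividing by it shows that \<open>h\<close>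
  is a function of \<open>\<phi>\<close>. Conversely, if \<open>h = k \<circ> \<phi>\<close>, then \<open>h \<cdot> Tg = T(kg)\<close>, hence
  \<open>T\<^sup>*(hf) = k \<cdot> T\<^sup>*f\<close>, which gives the commutation.

  For the conditional expectation, the functions measurable with respect to \<open>\<phi>\<inverse>(\<A>)\<close> are those
  of the form \<open>k \<circ> \<phi>\<close>, and \<open>E\<close> fixes exactly these; it is well-behaved because \<open>h < \<infinity>\<close> makes
  \<open>\<mu>\<^sub>w\<close> \<open>\<sigma>\<close>-finite on \<open>\<phi>\<inverse>(\<A>)\<close>.

  For the equality of the two operators, testing with one function shows that their weights agree
  almost everywhere, and a computation turns this into \<open>H \<circ> \<phi> = (h \<cdot> h \<circ> \<phi>)\<^bsup>1/2\<^esup>\<close> on the set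
  \<open>{h > 0, w \<noteq> 0}\<close>, where \<open>H\<close> is the Radon-Nikodym derivative belonging to \<open>w\<^bsub>1/2\<^esub>\<close>
  (\<open>weights_eq_iff\<close>). If \<open>h = k \<circ> \<phi>\<close>, then \<open>H = (kh)\<^bsup>1/2\<^esup>\<close> by a direct calculation. Conversely, with
  \<open>p = H / h\<^bsup>1/2\<^esup>\<close> the equality says \<open>p \<circ> \<phi> = h\<^bsup>1/2\<^esup>\<close>, but only where \<open>h > 0\<close>. As \<open>p \<circ> \<phi> = E(h\<^bsup>1/2\<^esup>)\<close>,
  both sides have the same weighted integral, and \<open>h\<^bsup>1/2\<^esup> \<le> p \<circ> \<phi>\<close> is trivial where \<open>h = 0\<close>; so they
  agree also where \<open>h = 0\<close>.

  The adjoint is obtained concretely: \<open>T\<^sup>*f\<close> is the Radon-Nikodym derivative of the image under \<open>\<phi>\<close>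
  of the complex density \<open>w\<^sup>* f\<close>, where \<open>w\<^sup>*\<close> is the complex conjugate of \<open>w\<close> (\<open>is_adj_exists\<close>).\<close>

section \<open>Preliminaries on measurable and square-integrable functions\<close>

text \<open>The Doob-Dynkin lemma for nonnegative functions. The factorization is compatible with the
  operations that build measurable functions from indicators, so induction applies.\<close>

lemma borel_measurable_vimage_algebra_factor:
  fixes u :: "'a \<Rightarrow> ennreal"
  assumes "u \<in> borel_measurable (vimage_algebra X f M)" "f \<in> X \<rightarrow> space M"
  shows "\<exists>k\<in>borel_measurable M. \<forall>x\<in>X. u x = k (f x)"
  using assms(1)
proof (induction u rule: borel_measurable_induct)
  case (cong u v)
  then show ?case by simp
next
  case (set A)
  then obtain B where "B \<in> sets M" "A = f -` B \<inter> X"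
    using sets_vimage_algebra2[OF assms(2)] by auto
  then show ?case
    by (intro bexI[of _ "indicator B"]) (auto simp: indicator_def)
next
  case (mult u c)
  then obtain k where [measurable]: "k \<in> borel_measurable M" and "\<forall>x\<in>X. u x = k (f x)"
    by blast
  then show ?case by (intro bexI[of _ "\<lambda>y. c * k y"]) auto
next
  case (add u v)
  then obtain k l where [measurable]: "k \<in> borel_measurable M" "l \<in> borel_measurable M"
    and "\<forall>x\<in>X. u x = k (f x)" "\<forall>x\<in>X. v x = l (f x)"
    by blast
  then show ?case by (intro bexI[of _ "\<lambda>y. l y + k y"]) auto
next
  case (seq U)
  then obtain K where [measurable]: "\<And>i. K i \<in> borel_measurable M"
    and "\<And>i. \<forall>x\<in>X. U i x = K i (f x)"
    by metis
  then show ?case by (intro bexI[of _ "\<lambda>y. SUP i. K i y"]) (auto simp: image_comp)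
qed

text \<open>The difference \<open>g - f\<close> is nonnegative with integral \<open>0\<close>.\<close>

lemma nn_integral_antimono_imp_AE_eq:
  assumes [measurable]: "f \<in> borel_measurable M" "g \<in> borel_measurable M"
    and le: "AE x in M. f x \<le> g x"
    and int: "integral\<^sup>N M g \<le> integral\<^sup>N M f" "integral\<^sup>N M f < \<infinity>"
  shows "AE x in M. f x = g x"
proof -
  have "(\<integral>\<^sup>+x. g x - f x \<partial>M) = integral\<^sup>N M g - integral\<^sup>N M f"
    using le int by (intro nn_integral_diff) auto
  also have "\<dots> = 0"
    using int by (simp add: diff_eq_0_iff_ennreal le_less_trans)
  finally have "AE x in M. g x - f x = 0"
    by (subst (asm) nn_integral_0_iff_AE) auto
  moreover have "AE x in M. f x \<noteq> \<infinity>"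
    using int by (intro nn_integral_noteq_infinite) auto
  ultimately show ?thesis
    using le by eventually_elim (auto simp: diff_eq_0_iff_ennreal intro: antisym)
qed

lemma square_integrableI:
  assumes "f \<in> borel_measurable M" "(\<integral>\<^sup>+x. ennreal ((cmod (f x))\<^sup>2) \<partial>M) < \<infinity>"
  shows "f \<in> square_integrable M"
  using assms unfolding square_integrable_def by (auto intro!: integrableI_bounded)

lemma square_integrable_measurable [measurable_dest]:
  "f \<in> square_integrable M \<Longrightarrow> f \<in> borel_measurable M"
  by (simp add: square_integrable_def)

lemma square_integrable_nn_integral:
  "f \<in> square_integrable M \<Longrightarrow> (\<integral>\<^sup>+x. ennreal ((cmod (f x))\<^sup>2) \<partial>M) < \<infinity>"
  by (simp add: square_integrable_def real_integrable_def less_top)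

text \<open>The domination test through which nearly all memberships in \<open>L\<^sup>2\<close> are derived.\<close>

lemma square_integrable_bound:
  assumes g: "g \<in> square_integrable M" and [measurable]: "f \<in> borel_measurable M"
    and le: "AE x in M. cmod (f x) \<le> c * cmod (g x)"
  shows "f \<in> square_integrable M"
proof -
  have "integrable M (\<lambda>x. c\<^sup>2 * (cmod (g x))\<^sup>2)"
    using g by (simp add: square_integrable_def)
  then have "integrable M (\<lambda>x. (cmod (f x))\<^sup>2)"
  proof (rule Bochner_Integration.integrable_bound)
    show "AE x in M. norm ((cmod (f x))\<^sup>2) \<le> norm (c\<^sup>2 * (cmod (g x))\<^sup>2)"
      using le
    proof eventually_elim
      case (elim x)
      then have "(cmod (f x))\<^sup>2 \<le> (c * cmod (g x))\<^sup>2"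
        by (intro power_mono) auto
      then show ?case by (simp add: power_mult_distrib)
    qed
  qed measurable
  then show ?thesis by (simp add: square_integrable_def)
qed

lemma square_integrable_cmult:
  assumes "f \<in> square_integrable M"
  shows "(\<lambda>x. c * f x) \<in> square_integrable M"
  by (rule square_integrable_bound[OF assms, where c = "cmod c"])
     (use assms in \<open>auto simp: norm_mult dest: square_integrable_measurable\<close>)

lemma square_integrable_add:
  assumes f: "f \<in> square_integrable M" and g: "g \<in> square_integrable M"
  shows "(\<lambda>x. f x + g x) \<in> square_integrable M"
proof -
  note [measurable] = f g
  have "integrable M (\<lambda>x. 2 * (cmod (f x))\<^sup>2 + 2 * (cmod (g x))\<^sup>2)"
    using f g by (simp add: square_integrable_def)
  then have "integrable M (\<lambda>x. (cmod (f x + g x))\<^sup>2)"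
  proof (rule Bochner_Integration.integrable_bound)
    have "(cmod (a + b))\<^sup>2 \<le> 2 * (cmod a)\<^sup>2 + 2 * (cmod b)\<^sup>2" for a b
    proof -
      have "(cmod (a + b))\<^sup>2 \<le> (cmod a + cmod b)\<^sup>2"
        by (intro power_mono norm_triangle_ineq) auto
      also have "\<dots> \<le> 2 * (cmod a)\<^sup>2 + 2 * (cmod b)\<^sup>2"
        using sum_squares_bound[of "cmod a" "cmod b"] by (simp add: power2_sum)
      finally show ?thesis .
    qed
    then show "AE x in M. norm ((cmod (f x + g x))\<^sup>2) \<le> norm (2 * (cmod (f x))\<^sup>2 + 2 * (cmod (g x))\<^sup>2)"
      by (auto intro!: AE_I2)
  qed measurable
  then show ?thesis by (simp add: square_integrable_def)
qed

lemma borel_measurable_cnj [measurable (raw)]: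
  "f \<in> borel_measurable M \<Longrightarrow> (\<lambda>x. cnj (f x)) \<in> borel_measurable M"
  by (rule measurable_compose[OF _ borel_measurable_continuous_onI]) (auto intro: continuous_intros)

lemma square_integrable_mult_cnj:
  assumes f: "f \<in> square_integrable M" and g: "g \<in> square_integrable M"
  shows "integrable M (\<lambda>x. f x * cnj (g x))"
proof -
  note [measurable] = f g
  have "integrable M (\<lambda>x. (cmod (f x))\<^sup>2 + (cmod (g x))\<^sup>2)"
    using f g by (simp add: square_integrable_def)
  then show ?thesis
  proof (rule Bochner_Integration.integrable_bound)
    have "cmod a * cmod b \<le> (cmod a)\<^sup>2 + (cmod b)\<^sup>2" for a b
      using sum_squares_bound[of "cmod a" "cmod b"]
        mult_nonneg_nonneg[OF norm_ge_zero[of a] norm_ge_zero[of b]]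
      unfolding mult.assoc by linarith
    then show "AE x in M. norm (f x * cnj (g x)) \<le> norm ((cmod (f x))\<^sup>2 + (cmod (g x))\<^sup>2)"
      by (auto simp: norm_mult)
  qed measurable
qed

lemma L2_class: "f \<in> square_integrable M \<Longrightarrow> l2_class M f \<in> L2 M"
  by (simp add: L2_def l2_class_def quotientI)

lemma L2_cases:
  assumes "F \<in> L2 M"
  obtains f where "f \<in> square_integrable M" "F = l2_class M f"
  using assms by (auto simp: L2_def l2_class_def elim: quotientE)

lemma l2_class_eq_iff:
  assumes "f \<in> square_integrable M" "g \<in> square_integrable M"
  shows "l2_class M f = l2_class M g \<longleftrightarrow> (AE x in M. f x = g x)"
  using eq_equiv_class_iff[OF equiv_ae_rel, of f M g] assms
  by (simp add: l2_class_def ae_rel_def)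

lemma l2_norm_class:
  assumes "f \<in> square_integrable M"
  shows "ennreal ((l2_norm M (l2_class M f))\<^sup>2) = (\<integral>\<^sup>+x. ennreal ((cmod (f x))\<^sup>2) \<partial>M)"
proof -
  note r = l2_rep_class[OF assms]
  have "(\<integral>x. (cmod (l2_rep (l2_class M f) x))\<^sup>2 \<partial>M) = (\<integral>x. (cmod (f x))\<^sup>2 \<partial>M)"
    using r assms by (intro integral_cong_AE) (auto simp: square_integrable_def elim: AE_mp)
  then show ?thesis
    using assms by (simp add: l2_norm_def nn_integral_eq_integral square_integrable_def)
qed

text \<open>A positive test function stands in for the constant \<open>1\<close>, which is not square integrable if the
  measure is infinite.\<close>

lemma (in sigma_finite_measure) ex_positive_square_integrable:
  obtains g :: "'a \<Rightarrow> real" where "g \<in> borel_measurable M" "\<And>x. g x > 0"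
    "(\<lambda>x. complex_of_real (g x)) \<in> square_integrable M"
proof -
  obtain f :: "'a \<Rightarrow> real" where f: "f \<in> borel_measurable M" "\<And>x. f x > 0" "integrable M f"
    using obtain_positive_integrable_function by metis
  note [measurable] = f(1)
  show ?thesis
  proof (rule that[of "\<lambda>x. sqrt (f x)"])
    have "(cmod (complex_of_real (sqrt (f x))))\<^sup>2 = f x" for x
      using f(2)[of x] by (simp add: norm_of_real)
    then show "(\<lambda>x. complex_of_real (sqrt (f x))) \<in> square_integrable M"
      using f by (simp add: square_integrable_def)
  qed (use f in auto)
qed

section \<open>Pushing forward densities along the symbol\<close>

locale weighted_symbol = sigma_finite_measure M for M :: "'a measure" +
  fixes \<phi> :: "'a \<Rightarrow> 'a" and w :: "'a \<Rightarrow> complex"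
  assumes phi [measurable]: "\<phi> \<in> measurable M M"
    and w [measurable]: "w \<in> borel_measurable M"
    and ac: "absolutely_continuous M (distr (weighted_measure M w) M \<phi>)"
begin

lemma AE_weighted: "(AE x in weighted_measure M w. P x) \<longleftrightarrow> (AE x in M. w x \<noteq> 0 \<longrightarrow> P x)"
  unfolding weighted_measure_def by (subst AE_density) auto

text \<open>Absolute continuity in the form in which it is used: composition with \<open>\<phi>\<close> respects null sets,
  as long as only the points with \<open>w \<noteq> 0\<close> are looked at.\<close>

lemma AE_comp_symbol:
  assumes "AE x in M. P x"
  shows "AE x in M. w x \<noteq> 0 \<longrightarrow> P (\<phi> x)"
proof -
  obtain N where N: "N \<in> null_sets M" "{x \<in> space M. \<not> P x} \<subseteq> N"
    using assms unfolding eventually_ae_filter by auto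
  then have "N \<in> null_sets (distr (weighted_measure M w) M \<phi>)"
    using ac by (auto simp: absolutely_continuous_def)
  then have "AE x in distr (weighted_measure M w) M \<phi>. x \<notin> N"
    by (rule AE_not_in)
  then have "AE x in weighted_measure M w. \<phi> x \<notin> N"
    using N by (subst (asm) AE_distr_iff) (auto simp: weighted_measure_def)
  then have "AE x in M. w x \<noteq> 0 \<longrightarrow> \<phi> x \<notin> N"
    by (simp add: AE_weighted)
  then show ?thesis
    using AE_space by eventually_elim (use N measurable_space[OF phi] in auto)
qed

text \<open>The transfer operator. For a nonnegative \<open>f\<close> one has \<open>pushforward (|w|\<^sup>2 f) = h \<cdot> E(f) \<circ> \<phi>\<inverse>\<close>;
  working with it avoids the factor \<open>E(f) \<circ> \<phi>\<inverse>\<close>, which is only defined through a choice.\<close>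

definition pushforward :: "('a \<Rightarrow> ennreal) \<Rightarrow> 'a \<Rightarrow> ennreal" where
  "pushforward u = RN_deriv M (distr (density M u) M \<phi>)"

lemma pushforward_measurable [measurable]: "pushforward u \<in> borel_measurable M"
  by (simp add: pushforward_def)

lemma h_deriv_pushforward:
  "h_deriv M \<phi> v = pushforward (\<lambda>x. ennreal ((cmod (v x))\<^sup>2))"
  by (simp add: h_deriv_def pushforward_def weighted_measure_def)

lemma h_deriv_measurable [measurable]: "h_deriv M \<phi> v \<in> borel_measurable M"
  by (simp add: h_deriv_pushforward)

text \<open>One test function \<open>g\<close> in the domain determines the weight where \<open>g \<circ> \<phi> \<noteq> 0\<close>. The argument
  works with the representative that the operator itself evaluates, so that only \<open>\<mu>\<^sub>w\<close>-null sets
  have to be ignored.\<close>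

lemma wcomp_op_eqD:
  assumes eq: "wcomp_op M \<phi> v = wcomp_op M \<phi> v'"
    and [measurable]: "v \<in> borel_measurable M"
    and 0: "\<And>x. w x = 0 \<Longrightarrow> v x = 0" "\<And>x. w x = 0 \<Longrightarrow> v' x = 0"
    and g: "g \<in> square_integrable M" "wcomp_fun \<phi> v g \<in> square_integrable M"
      "AE x in M. w x \<noteq> 0 \<longrightarrow> g (\<phi> x) \<noteq> 0"
  shows "AE x in M. v x = v' x"
proof -
  define r where "r = l2_rep (l2_class M g)"
  have r: "r \<in> square_integrable M" "AE x in M. r x = g x"
    using l2_rep_class[OF g(1)] by (auto simp: r_def)
  note [measurable] = square_integrable_measurable[OF r(1)]
  have rg: "AE x in M. w x \<noteq> 0 \<longrightarrow> r (\<phi> x) = g (\<phi> x)"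
    by (rule AE_comp_symbol[OF r(2)])
  have v: "wcomp_fun \<phi> v r \<in> square_integrable M"
  proof (rule square_integrable_cong[OF g(2)])
    show "wcomp_fun \<phi> v r \<in> borel_measurable M"
      unfolding wcomp_fun_def by measurable
    show "AE x in M. wcomp_fun \<phi> v g x = wcomp_fun \<phi> v r x"
      using rg by eventually_elim (use 0 in \<open>auto simp: wcomp_fun_def\<close>)
  qed
  have "wcomp_op M \<phi> v (l2_class M g) = Some (l2_class M (wcomp_fun \<phi> v r))"
    using v L2_class[OF g(1)] by (simp add: wcomp_op_def r_def)
  moreover have "wcomp_op M \<phi> v' (l2_class M g) =
      (if wcomp_fun \<phi> v' r \<in> square_integrable M then Some (l2_class M (wcomp_fun \<phi> v' r)) else None)"
    using L2_class[OF g(1)] by (simp add: wcomp_op_def r_def)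
  ultimately have "wcomp_fun \<phi> v' r \<in> square_integrable M"
      "l2_class M (wcomp_fun \<phi> v r) = l2_class M (wcomp_fun \<phi> v' r)"
    using eq by (auto split: if_splits)
  then have "AE x in M. wcomp_fun \<phi> v r x = wcomp_fun \<phi> v' r x"
    using v by (simp add: l2_class_eq_iff)
  then show ?thesis
    using rg g(3)
  proof eventually_elim
    case (elim x)
    then show ?case by (cases "w x = 0") (auto simp: 0 wcomp_fun_def)
  qed
qed

lemma wcomp_op_cong:
  assumes [measurable]: "v \<in> borel_measurable M" "v' \<in> borel_measurable M"
    and eq: "AE x in M. v x = v' x"
  shows "wcomp_op M \<phi> v = wcomp_op M \<phi> v'"
proof (rule ext)
  fix F
  show "wcomp_op M \<phi> v F = wcomp_op M \<phi> v' F"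
  proof (cases "F \<in> L2 M")
    case True
    then obtain f where f: "f \<in> square_integrable M" "F = l2_class M f"
      by (rule L2_cases)
    define r where "r = l2_rep F"
    have [measurable]: "r \<in> borel_measurable M"
      using l2_rep_class(1)[OF f(1)] by (simp add: r_def f(2) square_integrable_measurable)
    have [measurable]: "wcomp_fun \<phi> v r \<in> borel_measurable M" "wcomp_fun \<phi> v' r \<in> borel_measurable M"
      unfolding wcomp_fun_def by measurable
    have e: "AE x in M. wcomp_fun \<phi> v r x = wcomp_fun \<phi> v' r x"
      using eq by eventually_elim (simp add: wcomp_fun_def)
    then have e': "AE x in M. wcomp_fun \<phi> v' r x = wcomp_fun \<phi> v r x"
      by eventually_elim simp
    have "wcomp_fun \<phi> v r \<in> square_integrable M \<longleftrightarrow> wcomp_fun \<phi> v' r \<in> square_integrable M"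
      using square_integrable_cong[OF _ _ e] square_integrable_cong[OF _ _ e'] by auto
    then show ?thesis
      using True l2_class_eq[OF _ _ e] by (auto simp: wcomp_op_def r_def[symmetric])
  qed (simp add: wcomp_op_def)
qed

text \<open>A density that vanishes where \<open>w\<close> does is absolutely continuous with respect to \<open>\<mu>\<^sub>w\<close>, so that
  its image under \<open>\<phi>\<close> has a Radon-Nikodym derivative.\<close>

lemma density_pushforward:
  assumes u [measurable]: "u \<in> borel_measurable M" and 0: "\<And>x. w x = 0 \<Longrightarrow> u x = 0"
  shows "density M (pushforward u) = distr (density M u) M \<phi>"
  unfolding pushforward_def
proof (rule density_RN_deriv)
  show "absolutely_continuous M (distr (density M u) M \<phi>)"
    unfolding absolutely_continuous_def
  proof
    fix N assume N: "N \<in> null_sets M"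
    then have [measurable]: "N \<in> sets M" by auto
    have "AE x in M. w x \<noteq> 0 \<longrightarrow> \<phi> x \<notin> N"
      using AE_comp_symbol[OF AE_not_in[OF N]] .
    then have "AE x in density M u. \<phi> x \<notin> N"
      by (subst AE_density) (use 0 in \<open>auto elim!: eventually_mono\<close>)
    then have "AE x in distr (density M u) M \<phi>. x \<notin> N"
      by (subst AE_distr_iff) auto
    then show "N \<in> null_sets (distr (density M u) M \<phi>)"
      by (subst (asm) AE_iff_null_sets[symmetric]) auto
  qed
qed simp

lemma nn_integral_pushforward:
  assumes u [measurable]: "u \<in> borel_measurable M" and 0: "\<And>x. w x = 0 \<Longrightarrow> u x = 0"
    and g [measurable]: "g \<in> borel_measurable M"
  shows "(\<integral>\<^sup>+x. u x * g (\<phi> x) \<partial>M) = (\<integral>\<^sup>+x. pushforward u x * g x \<partial>M)"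
proof -
  have "(\<integral>\<^sup>+x. u x * g (\<phi> x) \<partial>M) = (\<integral>\<^sup>+x. g x \<partial>distr (density M u) M \<phi>)"
    by (subst nn_integral_distr) (auto simp: nn_integral_density)
  also have "\<dots> = (\<integral>\<^sup>+x. g x \<partial>density M (pushforward u))"
    by (simp add: density_pushforward[OF u 0])
  finally show ?thesis by (simp add: nn_integral_density)
qed

lemma integral_pushforward:
  fixes g :: "'a \<Rightarrow> complex" and u :: "'a \<Rightarrow> real"
  assumes u [measurable]: "u \<in> borel_measurable M" and 0: "\<And>x. w x = 0 \<Longrightarrow> u x = 0"
    and u0: "\<And>x. 0 \<le> u x"
    and fin: "AE x in M. pushforward (\<lambda>x. ennreal (u x)) x =
      ennreal (enn2real (pushforward (\<lambda>x. ennreal (u x)) x))"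
    and g [measurable]: "g \<in> borel_measurable M"
  shows "(\<integral>x. u x *\<^sub>R g (\<phi> x) \<partial>M) =
    (\<integral>x. enn2real (pushforward (\<lambda>x. ennreal (u x)) x) *\<^sub>R g x \<partial>M)"
proof -
  let ?q = "pushforward (\<lambda>x. ennreal (u x))"
  have "(\<integral>x. u x *\<^sub>R g (\<phi> x) \<partial>M) = (\<integral>x. g (\<phi> x) \<partial>density M (\<lambda>x. ennreal (u x)))"
    by (rule integral_density[symmetric]) (auto simp: u0)
  also have "\<dots> = (\<integral>x. g x \<partial>distr (density M (\<lambda>x. ennreal (u x))) M \<phi>)"
    by (rule integral_distr[symmetric]) auto
  also have "distr (density M (\<lambda>x. ennreal (u x))) M \<phi> = density M ?q"
    by (rule density_pushforward[symmetric]) (auto simp: 0)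
  also have "density M ?q = density M (\<lambda>x. ennreal (enn2real (?q x)))"
    by (rule density_cong) (use fin in auto)
  also have "(\<integral>x. g x \<partial>\<dots>) = (\<integral>x. enn2real (?q x) *\<^sub>R g x \<partial>M)"
    by (rule integral_density) auto
  finally show ?thesis .
qed

lemma pushforward_unique:
  assumes u [measurable]: "u \<in> borel_measurable M" and q [measurable]: "q \<in> borel_measurable M"
    and eq: "\<And>A. A \<in> sets M \<Longrightarrow> (\<integral>\<^sup>+x. u x * indicator A (\<phi> x) \<partial>M) = (\<integral>\<^sup>+x. q x * indicator A x \<partial>M)"
  shows "AE x in M. pushforward u x = q x"
proof -
  have "density M q = distr (density M u) M \<phi>"
  proof (rule measure_eqI)
    fix A assume "A \<in> sets (density M q)"
    then have A [measurable]: "A \<in> sets M" by simp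
    have "emeasure (distr (density M u) M \<phi>) A = (\<integral>\<^sup>+x. indicator A x \<partial>distr (density M u) M \<phi>)"
      by simp
    also have "\<dots> = (\<integral>\<^sup>+x. u x * indicator A (\<phi> x) \<partial>M)"
      by (subst nn_integral_distr) (auto simp: nn_integral_density simp del: nn_integral_indicator)
    finally show "emeasure (density M q) A = emeasure (distr (density M u) M \<phi>) A"
      using eq[OF A] by (simp add: emeasure_density)
  qed simp
  from RN_deriv_unique[OF q this] show ?thesis
    unfolding pushforward_def by eventually_elim simp
qed

abbreviation h :: "'a \<Rightarrow> ennreal" where "h \<equiv> h_deriv M \<phi> w"

definition hr :: "'a \<Rightarrow> real" where "hr x = enn2real (h x)"

lemma hr_measurable [measurable]: "hr \<in> borel_measurable M"
  unfolding hr_def[abs_def] by measurable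

lemma hr_nonneg [simp]: "0 \<le> hr x"
  by (simp add: hr_def)

lemma nn_integral_weight:
  assumes [measurable]: "g \<in> borel_measurable M"
  shows "(\<integral>\<^sup>+x. ennreal ((cmod (w x))\<^sup>2) * g (\<phi> x) \<partial>M) = (\<integral>\<^sup>+x. h x * g x \<partial>M)"
  unfolding h_deriv_pushforward by (rule nn_integral_pushforward) auto

text \<open>The set \<open>{h = 0}\<close> has \<open>h\<close>-measure \<open>0\<close>, so its preimage under \<open>\<phi>\<close> is a \<open>\<mu>\<^sub>w\<close>-null set.\<close>

lemma h_comp_symbol_pos: "AE x in M. w x \<noteq> 0 \<longrightarrow> h (\<phi> x) \<noteq> 0"
proof -
  let ?Z = "{x \<in> space M. h x = 0}"
  have "(\<integral>\<^sup>+x. ennreal ((cmod (w x))\<^sup>2) * indicator ?Z (\<phi> x) \<partial>M) = (\<integral>\<^sup>+x. h x * indicator ?Z x \<partial>M)"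
    by (rule nn_integral_weight) measurable
  also have "\<dots> = (\<integral>\<^sup>+x. 0 \<partial>M)"
    by (rule nn_integral_cong) (auto simp: indicator_def)
  finally have "(\<integral>\<^sup>+x. ennreal ((cmod (w x))\<^sup>2) * indicator ?Z (\<phi> x) \<partial>M) = 0"
    by simp
  then have "AE x in M. ennreal ((cmod (w x))\<^sup>2) * indicator ?Z (\<phi> x) = 0"
    by (subst (asm) nn_integral_0_iff_AE) auto
  then show ?thesis
    using AE_space by eventually_elim (use measurable_space[OF phi] in \<open>auto simp: indicator_def split: if_splits\<close>)
qed

end


section \<open>The adjoint of a bounded weighted composition operator\<close>

locale bounded_weighted_composition = weighted_symbol +
  assumes bounded: "bounded_on_L2 M (wcomp_op M \<phi> w)"
begin

abbreviation T :: "('a \<Rightarrow> complex) \<Rightarrow> 'a \<Rightarrow> complex" where "T \<equiv> wcomp_fun \<phi> w"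

lemma T_square_integrable [simp, intro]:
  assumes f: "f \<in> square_integrable M"
  shows "T f \<in> square_integrable M"
proof (rule ccontr)
  assume "T f \<notin> square_integrable M"
  then have "wcomp_op M \<phi> w (l2_class M f) = None"
    using wcomp_op_class[OF phi w ac f] by simp
  moreover have "l2_class M f \<in> dom (wcomp_op M \<phi> w)"
    using bounded L2_class[OF f] by (simp add: bounded_on_L2_def)
  ultimately show False by auto
qed

lemma wcomp_op_T:
  "f \<in> square_integrable M \<Longrightarrow> wcomp_op M \<phi> w (l2_class M f) = Some (l2_class M (T f))"
  using wcomp_op_class[OF phi w ac] by simp

text \<open>The operator bound as an inequality of nonnegative integrals, with a constant that may be
  divided by.\<close>

lemma T_bound:
  obtains C :: real where "C > 0" "\<And>f. f \<in> square_integrable M \<Longrightarrow>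
    (\<integral>\<^sup>+x. ennreal ((cmod (T f x))\<^sup>2) \<partial>M) \<le> ennreal C * (\<integral>\<^sup>+x. ennreal ((cmod (f x))\<^sup>2) \<partial>M)"
proof -
  obtain K where K: "\<And>F. F \<in> L2 M \<Longrightarrow> l2_norm M (the (wcomp_op M \<phi> w F)) \<le> K * l2_norm M F"
    using bounded by (auto simp: bounded_on_L2_def)
  have "(\<integral>\<^sup>+x. ennreal ((cmod (T f x))\<^sup>2) \<partial>M) \<le> ennreal (K\<^sup>2 + 1) * (\<integral>\<^sup>+x. ennreal ((cmod (f x))\<^sup>2) \<partial>M)"
    if f: "f \<in> square_integrable M" for f
  proof -
    let ?F = "l2_class M f" and ?G = "l2_class M (T f)"
    have "l2_norm M ?G \<le> K * l2_norm M ?F"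
      using K[OF L2_class[OF f]] wcomp_op_T[OF f] by simp
    moreover have "0 \<le> l2_norm M ?G"
      by (simp add: l2_norm_def)
    ultimately have "(l2_norm M ?G)\<^sup>2 \<le> (K * l2_norm M ?F)\<^sup>2"
      by (rule power_mono)
    also have "\<dots> \<le> (K\<^sup>2 + 1) * (l2_norm M ?F)\<^sup>2"
      by (simp add: power_mult_distrib distrib_right)
    finally have "ennreal ((l2_norm M ?G)\<^sup>2) \<le> ennreal ((K\<^sup>2 + 1) * (l2_norm M ?F)\<^sup>2)"
      by (rule ennreal_leI)
    then have "ennreal ((l2_norm M ?G)\<^sup>2) \<le> ennreal (K\<^sup>2 + 1) * ennreal ((l2_norm M ?F)\<^sup>2)"
      by (simp add: ennreal_mult)
    then show ?thesis
      using l2_norm_class[OF f] l2_norm_class[OF T_square_integrable[OF f]] by (simp only:)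
  qed
  moreover have "K\<^sup>2 + 1 > 0"
    by (simp add: add_nonneg_pos)
  ultimately show ?thesis
    by (rule that[rotated])
qed

lemma T_norm_sq: "ennreal ((cmod (T f x))\<^sup>2) = ennreal ((cmod (w x))\<^sup>2) * ennreal ((cmod (f (\<phi> x)))\<^sup>2)"
  by (simp add: wcomp_fun_def norm_mult power_mult_distrib ennreal_mult)

text \<open>Boundedness of \<open>T\<close> is \<open>\<integral>h |f|\<^sup>2 \<le> C \<integral>|f|\<^sup>2\<close> for all \<open>f\<close>, and this bounds \<open>h\<close> by \<open>C\<close>.\<close>

lemma h_bounded:
  obtains C :: real where "C > 0" "AE x in M. h x \<le> ennreal C"
proof -
  obtain C :: real where C: "C > 0" "\<And>f. f \<in> square_integrable M \<Longrightarrow>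
    (\<integral>\<^sup>+x. ennreal ((cmod (T f x))\<^sup>2) \<partial>M) \<le> ennreal C * (\<integral>\<^sup>+x. ennreal ((cmod (f x))\<^sup>2) \<partial>M)"
    using T_bound by metis
  obtain g :: "'a \<Rightarrow> real" where g: "g \<in> borel_measurable M" "\<And>x. g x > 0"
      "(\<lambda>x. complex_of_real (g x)) \<in> square_integrable M"
    using ex_positive_square_integrable by metis
  note [measurable] = g(1)
  define A where "A = {x \<in> space M. ennreal C < h x}"
  have [measurable]: "A \<in> sets M" unfolding A_def by measurable
  define f where "f x = complex_of_real (indicator A x * g x)" for x
  have [measurable]: "f \<in> borel_measurable M" unfolding f_def[abs_def] by measurable
  have f: "f \<in> square_integrable M"
    by (rule square_integrable_bound[OF g(3), where c = 1]) (auto simp: f_def indicator_def)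
  let ?n = "\<lambda>x. ennreal ((cmod (f x))\<^sup>2)"
  have fin: "(\<integral>\<^sup>+x. ?n x \<partial>M) < \<infinity>"
    by (rule square_integrable_nn_integral[OF f])
  \<comment> \<open>On \<open>A\<close> the function \<open>h\<close> exceeds \<open>C\<close> although its integral against
    \<open>|f|\<^sup>2\<close> is at most that of \<open>C\<close>.\<close>
  have "AE x in M. ennreal C * ?n x = h x * ?n x"
  proof (rule nn_integral_antimono_imp_AE_eq)
    show "AE x in M. ennreal C * ?n x \<le> h x * ?n x"
      by (auto simp: f_def A_def indicator_def intro!: mult_right_mono)
    have "(\<integral>\<^sup>+x. h x * ?n x \<partial>M) = (\<integral>\<^sup>+x. ennreal ((cmod (T f x))\<^sup>2) \<partial>M)"
      by (simp add: T_norm_sq nn_integral_weight[where g = ?n])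
    also have "\<dots> \<le> ennreal C * (\<integral>\<^sup>+x. ?n x \<partial>M)"
      by (rule C(2)[OF f])
    finally show "(\<integral>\<^sup>+x. h x * ?n x \<partial>M) \<le> (\<integral>\<^sup>+x. ennreal C * ?n x \<partial>M)"
      by (simp add: nn_integral_cmult)
    show "(\<integral>\<^sup>+x. ennreal C * ?n x \<partial>M) < \<infinity>"
      using fin by (simp add: nn_integral_cmult ennreal_mult_less_top)
  qed measurable
  then have "AE x in M. h x \<le> ennreal C"
    using AE_space
  proof eventually_elim
    case (elim x)
    show ?case
    proof (rule ccontr)
      assume less: "\<not> h x \<le> ennreal C"
      then have "?n x = ennreal ((g x)\<^sup>2)" "(g x)\<^sup>2 > 0"
        using elim g(2)[of x] by (auto simp: f_def A_def zero_less_power)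
      then show False
        using elim less C(1)
        by (cases "h x") (auto simp: ennreal_mult[symmetric] ennreal_top_mult ennreal_mult_eq_top_iff)
    qed
  qed
  with C(1) that show ?thesis by blast
qed

lemma h_eq_hr: "AE x in M. h x = ennreal (hr x)"
proof -
  obtain C :: real where "AE x in M. h x \<le> ennreal C"
    using h_bounded by metis
  then show ?thesis
    by eventually_elim (auto simp: hr_def ennreal_enn2real top.extremum_strict le_less_trans)
qed

lemma hr_bounded:
  obtains C :: real where "C > 0" "AE x in M. hr x \<le> C"
proof -
  obtain C :: real where C: "C > 0" "AE x in M. h x \<le> ennreal C"
    using h_bounded by metis
  have "AE x in M. hr x \<le> C"
    using C(2) by eventually_elim (use C(1) in \<open>auto simp: hr_def intro: enn2real_leI\<close>)
  with C(1) that show ?thesis by blast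
qed

lemma hr_comp_symbol_pos: "AE x in M. w x \<noteq> 0 \<longrightarrow> hr (\<phi> x) > 0"
  using h_comp_symbol_pos AE_comp_symbol[OF h_eq_hr]
  by eventually_elim (auto simp: less_le)

lemma nn_integral_weight_hr:
  assumes [measurable]: "g \<in> borel_measurable M"
  shows "(\<integral>\<^sup>+x. ennreal ((cmod (w x))\<^sup>2) * g (\<phi> x) \<partial>M) = (\<integral>\<^sup>+x. ennreal (hr x) * g x \<partial>M)"
  unfolding nn_integral_weight[OF assms]
  by (rule nn_integral_cong_AE) (use h_eq_hr in \<open>auto elim!: eventually_mono\<close>)

text \<open>The representatives \<open>K\<close> of the value of the adjoint at the class of \<open>f\<close>.\<close>

definition is_adj :: "('a \<Rightarrow> complex) \<Rightarrow> ('a \<Rightarrow> complex) \<Rightarrow> bool" where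
  "is_adj f K \<longleftrightarrow> K \<in> square_integrable M \<and>
     (\<forall>g\<in>square_integrable M. (\<integral>x. T g x * cnj (f x) \<partial>M) = (\<integral>x. g x * cnj (K x) \<partial>M))"

lemma is_adj_add:
  assumes f: "f1 \<in> square_integrable M" "f2 \<in> square_integrable M"
    and K: "is_adj f1 K1" "is_adj f2 K2"
  shows "is_adj (\<lambda>x. f1 x + f2 x) (\<lambda>x. K1 x + K2 x)"
  unfolding is_adj_def
proof (intro conjI ballI)
  show "(\<lambda>x. K1 x + K2 x) \<in> square_integrable M"
    using K by (auto simp: is_adj_def intro: square_integrable_add)
  fix g assume g: "g \<in> square_integrable M"
  show "(\<integral>x. T g x * cnj (f1 x + f2 x) \<partial>M) = (\<integral>x. g x * cnj (K1 x + K2 x) \<partial>M)"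
    using f g K by (simp add: is_adj_def distrib_left Bochner_Integration.integral_add
        square_integrable_mult_cnj)
qed

lemma is_adj_cmult:
  assumes "is_adj f K"
  shows "is_adj (\<lambda>x. c * f x) (\<lambda>x. c * K x)"
  using assms unfolding is_adj_def
  by (auto simp: mult.left_commute[of _ "cnj c"] intro: square_integrable_cmult)

lemma is_adj_unique:
  assumes "is_adj f K" "is_adj f L"
  shows "AE x in M. K x = L x"
proof -
  define D where "D x = K x + (-1) * L x" for x
  have KL: "K \<in> square_integrable M" "L \<in> square_integrable M"
    using assms by (auto simp: is_adj_def)
  then have D: "D \<in> square_integrable M"
    unfolding D_def[abs_def] by (intro square_integrable_add square_integrable_cmult)
  have "(\<integral>x. complex_of_real ((cmod (D x))\<^sup>2) \<partial>M) = (\<integral>x. D x * cnj (K x) - D x * cnj (L x) \<partial>M)"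
    unfolding complex_norm_square by (simp add: D_def algebra_simps)
  also have "\<dots> = (\<integral>x. D x * cnj (K x) \<partial>M) - (\<integral>x. D x * cnj (L x) \<partial>M)"
    by (intro Bochner_Integration.integral_diff square_integrable_mult_cnj D KL)
  also have "\<dots> = 0"
    using assms D by (auto simp: is_adj_def)
  finally have "(\<integral>x. (cmod (D x))\<^sup>2 \<partial>M) = 0"
    by (simp only: integral_complex_of_real of_real_eq_0_iff)
  moreover have "integrable M (\<lambda>x. (cmod (D x))\<^sup>2)"
    using D by (simp add: square_integrable_def)
  ultimately have "AE x in M. (cmod (D x))\<^sup>2 = 0"
    by (subst (asm) integral_nonneg_eq_0_iff_AE) auto
  then show ?thesis
    by eventually_elim (simp add: D_def)
qed

text \<open>All functions \<open>Tg\<close> vanish where \<open>w\<close> does, so the values of \<open>f\<close> there have no influence.\<close>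

lemma is_adj_cong:
  assumes K: "is_adj f K" and [measurable]: "f \<in> borel_measurable M" "f' \<in> borel_measurable M"
    and eq: "AE x in M. w x \<noteq> 0 \<longrightarrow> f x = f' x"
  shows "is_adj f' K"
  unfolding is_adj_def
proof (intro conjI ballI)
  show "K \<in> square_integrable M" using K by (simp add: is_adj_def)
  fix g assume g: "g \<in> square_integrable M"
  note [measurable] = T_square_integrable[OF g]
  have "(\<integral>x. T g x * cnj (f' x) \<partial>M) = (\<integral>x. T g x * cnj (f x) \<partial>M)"
  proof (rule integral_cong_AE)
    show "AE x in M. T g x * cnj (f' x) = T g x * cnj (f x)"
      using eq by eventually_elim (auto simp: wcomp_fun_def)
  qed measurable
  then show "(\<integral>x. T g x * cnj (f' x) \<partial>M) = (\<integral>x. g x * cnj (K x) \<partial>M)"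
    using K g by (simp add: is_adj_def)
qed

text \<open>If \<open>f\<close> has the phase of \<open>w\<close>, then the functional \<open>g \<mapsto> \<langle>Tg, f\<rangle>\<close> is integration
  against a positive measure, whose density is the value of the adjoint. That the density is square
  integrable follows by testing the functional with truncations \<open>p\<close> of the density itself: it
  gives \<open>\<parallel>p\<parallel>\<^sup>2 \<le> \<langle>Tp, f\<rangle>\<close>, so that \<open>\<parallel>p\<parallel>\<close> is bounded by \<open>\<parallel>T\<parallel> \<parallel>f\<parallel>\<close>.\<close>

lemma is_adj_exists_in_phase:
  fixes s :: "'a \<Rightarrow> real"
  assumes s [measurable]: "s \<in> borel_measurable M" and s0: "\<And>x. 0 \<le> s x"
    and s2: "(\<lambda>x. complex_of_real (s x)) \<in> square_integrable M"
  shows "\<exists>K. is_adj (\<lambda>x. sgn (w x) * complex_of_real (s x)) K"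
proof -
  obtain C :: real where C: "C > 0" "\<And>f. f \<in> square_integrable M \<Longrightarrow>
    (\<integral>\<^sup>+x. ennreal ((cmod (T f x))\<^sup>2) \<partial>M) \<le> ennreal C * (\<integral>\<^sup>+x. ennreal ((cmod (f x))\<^sup>2) \<partial>M)"
    using T_bound by metis
  obtain g0 :: "'a \<Rightarrow> real" where g0: "g0 \<in> borel_measurable M" "\<And>x. g0 x > 0"
      "(\<lambda>x. complex_of_real (g0 x)) \<in> square_integrable M"
    using ex_positive_square_integrable by metis
  note [measurable] = g0(1)
  define u where "u x = cmod (w x) * s x" for x
  have [measurable]: "u \<in> borel_measurable M" unfolding u_def[abs_def] by measurable
  have u0: "0 \<le> u x" for x using s0 by (simp add: u_def)
  define q where "q = pushforward (\<lambda>x. ennreal (u x))"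
  have [measurable]: "q \<in> borel_measurable M" by (simp add: q_def)
  let ?S = "\<integral>\<^sup>+x. ennreal ((s x)\<^sup>2) \<partial>M"
  have S: "?S < \<infinity>"
    using square_integrable_nn_integral[OF s2] by (simp add: norm_of_real)
  have test: "2 * (\<integral>\<^sup>+x. q x * ennreal (p x) \<partial>M)
      \<le> (\<integral>\<^sup>+x. ennreal ((p x)\<^sup>2) \<partial>M) + ennreal C * ?S"
    if [measurable]: "p \<in> borel_measurable M" and p: "\<And>x. 0 \<le> p x"
      "(\<lambda>x. complex_of_real (p x)) \<in> square_integrable M" for p :: "'a \<Rightarrow> real"
  proof -
    let ?T = "T (\<lambda>x. complex_of_real (p x))"
    note [measurable] = T_square_integrable[OF p(2)]
    have "(\<integral>\<^sup>+x. q x * ennreal (p x) \<partial>M) = (\<integral>\<^sup>+x. ennreal (u x) * ennreal (p (\<phi> x)) \<partial>M)"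
      unfolding q_def by (rule nn_integral_pushforward[symmetric]) (auto simp: u_def)
    then have "2 * (\<integral>\<^sup>+x. q x * ennreal (p x) \<partial>M) = (\<integral>\<^sup>+x. 2 * (ennreal (u x) * ennreal (p (\<phi> x))) \<partial>M)"
      by (simp add: nn_integral_cmult)
    also have "\<dots> \<le> (\<integral>\<^sup>+x. ennreal (1 / C) * ennreal ((cmod (?T x))\<^sup>2) + ennreal C * ennreal ((s x)\<^sup>2) \<partial>M)"
    proof (rule nn_integral_mono)
      fix x
      \<comment> \<open>The weights \<open>1/C\<close> and \<open>C\<close> are chosen so that the bound for \<open>T\<close> turns the first term
        into \<open>\<parallel>p\<parallel>\<^sup>2\<close> with coefficient \<open>1\<close>, less than the \<open>2\<close> on the left.\<close>
      define a where "a = cmod (w x) * p (\<phi> x)"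
      have "0 \<le> (a / sqrt C - sqrt C * s x)\<^sup>2" by simp
      also have "\<dots> = 1 / C * a\<^sup>2 + C * (s x)\<^sup>2 - 2 * (a * s x)"
        using C(1) by (simp add: power2_diff power_divide power_mult_distrib)
      finally have "2 * (a * s x) \<le> 1 / C * a\<^sup>2 + C * (s x)\<^sup>2" by simp
      then have "ennreal (2 * (a * s x)) \<le> ennreal (1 / C * a\<^sup>2 + C * (s x)\<^sup>2)"
        by (rule ennreal_leI)
      moreover have "cmod (?T x) = a"
        using p(1) by (simp add: wcomp_fun_def norm_mult a_def)
      moreover have "ennreal (2 * (a * s x)) = 2 * (ennreal (u x) * ennreal (p (\<phi> x)))"
      proof -
        have "2 * (a * s x) = 2 * (u x * p (\<phi> x))" by (simp add: a_def u_def)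
        then show ?thesis using p(1) u0 by (simp add: ennreal_mult)
      qed
      ultimately show "2 * (ennreal (u x) * ennreal (p (\<phi> x)))
          \<le> ennreal (1 / C) * ennreal ((cmod (?T x))\<^sup>2) + ennreal C * ennreal ((s x)\<^sup>2)"
        using C(1) by (simp add: ennreal_plus ennreal_mult[symmetric] del: ennreal_plus
            flip: ennreal_plus)
    qed
    also have "\<dots> = ennreal (1 / C) * (\<integral>\<^sup>+x. ennreal ((cmod (?T x))\<^sup>2) \<partial>M) + ennreal C * ?S"
      by (simp add: nn_integral_add nn_integral_cmult)
    also have "\<dots> \<le> ennreal (1 / C) * (ennreal C * (\<integral>\<^sup>+x. ennreal ((p x)\<^sup>2) \<partial>M)) + ennreal C * ?S"
      using C(2)[OF p(2)] by (intro add_mono mult_left_mono) (auto simp: norm_of_real)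
    also have "\<dots> = (\<integral>\<^sup>+x. ennreal ((p x)\<^sup>2) \<partial>M) + ennreal C * ?S"
      using C(1) by (simp add: mult.assoc[symmetric] ennreal_mult[symmetric])
    finally show ?thesis .
  qed
  \<comment> \<open>Testing with a positive function shows that the density is finite.\<close>
  have "2 * (\<integral>\<^sup>+x. q x * ennreal (g0 x) \<partial>M) < \<infinity>"
  proof (rule le_less_trans[OF test])
    show "(\<integral>\<^sup>+x. ennreal ((g0 x)\<^sup>2) \<partial>M) + ennreal C * ?S < \<infinity>"
      using square_integrable_nn_integral[OF g0(3)] S
      by (simp add: norm_of_real ennreal_mult_less_top)
  qed (use g0 in \<open>auto intro: less_imp_le\<close>)
  then have "(\<integral>\<^sup>+x. q x * ennreal (g0 x) \<partial>M) \<noteq> \<infinity>"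
    by (auto simp: ennreal_mult_eq_top_iff)
  then have "AE x in M. q x * ennreal (g0 x) \<noteq> \<infinity>"
    by (intro nn_integral_noteq_infinite) auto
  then have q_fin: "AE x in M. q x = ennreal (enn2real (q x))"
  proof eventually_elim
    case (elim x)
    then show ?case
      using g0(2)[of x] by (auto simp: ennreal_mult_eq_top_iff less_top)
  qed
  define K where "K x = complex_of_real (enn2real (q x))" for x
  have [measurable]: "K \<in> borel_measurable M" unfolding K_def[abs_def] by measurable
  define p where "p n x = min (enn2real (q x)) (real n * g0 x)" for n x
  have [measurable]: "p n \<in> borel_measurable M" for n unfolding p_def[abs_def] by measurable
  have p0: "0 \<le> p n x" for n x using g0(2)[of x] by (simp add: p_def)
  have p_le: "(\<integral>\<^sup>+x. ennreal ((p n x)\<^sup>2) \<partial>M) \<le> ennreal C * ?S" for n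
  proof -
    have p2: "(\<lambda>x. complex_of_real (p n x)) \<in> square_integrable M"
      by (rule square_integrable_bound[OF g0(3), where c = "real n"])
         (use p0 g0(2) in \<open>auto simp: norm_of_real p_def less_imp_le\<close>)
    let ?P = "\<integral>\<^sup>+x. ennreal ((p n x)\<^sup>2) \<partial>M"
    have P: "?P < \<infinity>"
      using square_integrable_nn_integral[OF p2] by (simp add: norm_of_real)
    have "ennreal ((p n x)\<^sup>2) \<le> q x * ennreal (p n x)" for x
    proof (cases "q x")
      case (real r)
      then have "(p n x)\<^sup>2 \<le> r * p n x"
        using p0[of n x] by (auto simp: p_def power2_eq_square intro!: mult_right_mono)
      then show ?thesis using real p0[of n x] by (simp add: ennreal_mult[symmetric] ennreal_leI)
    next
      case top
      then show ?thesis using g0(2)[of x] by (simp add: p_def min_def)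
    qed
    then have "?P \<le> (\<integral>\<^sup>+x. q x * ennreal (p n x) \<partial>M)"
      by (intro nn_integral_mono)
    then have "2 * ?P \<le> 2 * (\<integral>\<^sup>+x. q x * ennreal (p n x) \<partial>M)"
      by (rule mult_left_mono) simp
    also have "\<dots> \<le> ?P + ennreal C * ?S"
      by (rule test) (use p0 p2 in auto)
    \<comment> \<open>Cancelling one \<open>?P\<close> requires it to be finite, which is why the density is truncated.\<close>
    finally have "?P + ?P \<le> ?P + ennreal C * ?S"
      by (simp add: mult_2)
    then show ?thesis
      using P by (auto simp: ennreal_add_left_cancel_le)
  qed
  have K: "K \<in> square_integrable M"
  proof (rule square_integrableI)
    have lim: "(\<lambda>n. ennreal ((p n x)\<^sup>2)) \<longlonglongrightarrow> ennreal ((cmod (K x))\<^sup>2)" for x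
    proof (rule tendsto_eventually)
      obtain m where m: "enn2real (q x) < real m * g0 x"
        using reals_Archimedean3[of "g0 x"] g0(2)[of x] by metis
      show "\<forall>\<^sub>F n in sequentially. ennreal ((p n x)\<^sup>2) = ennreal ((cmod (K x))\<^sup>2)"
        using eventually_ge_at_top[of m]
      proof eventually_elim
        case (elim n)
        then have "real m * g0 x \<le> real n * g0 x"
          using g0(2)[of x] by (intro mult_right_mono) auto
        then show ?case using m by (simp add: p_def K_def)
      qed
    qed
    have "(\<integral>\<^sup>+x. ennreal ((cmod (K x))\<^sup>2) \<partial>M) = (\<integral>\<^sup>+x. liminf (\<lambda>n. ennreal ((p n x)\<^sup>2)) \<partial>M)"
      by (intro nn_integral_cong lim_imp_Liminf[OF _ lim, symmetric]) simp
    also have "\<dots> \<le> liminf (\<lambda>n. \<integral>\<^sup>+x. ennreal ((p n x)\<^sup>2) \<partial>M)"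
      by (rule nn_integral_liminf) measurable
    also have "\<dots> \<le> liminf (\<lambda>n::nat. ennreal C * ?S)"
      by (rule Liminf_mono) (use p_le in auto)
    also have "\<dots> < \<infinity>"
      using S by (simp add: Liminf_const ennreal_mult_less_top)
    finally show "(\<integral>\<^sup>+x. ennreal ((cmod (K x))\<^sup>2) \<partial>M) < \<infinity>" .
  qed measurable
  have "(\<integral>x. T g x * cnj (sgn (w x) * complex_of_real (s x)) \<partial>M) = (\<integral>x. g x * cnj (K x) \<partial>M)"
    if g: "g \<in> square_integrable M" for g
  proof -
    note [measurable] = g
    have "w x * cnj (sgn (w x)) = complex_of_real (cmod (w x))" for x
      by (simp add: sgn_div_norm scaleR_conv_of_real complex_norm_square[symmetric] power2_eq_square divide_simps)
    then have "T g x * cnj (sgn (w x) * complex_of_real (s x)) = u x *\<^sub>R g (\<phi> x)" for x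
      by (simp add: wcomp_fun_def u_def scaleR_conv_of_real mult_ac)
    then have "(\<integral>x. T g x * cnj (sgn (w x) * complex_of_real (s x)) \<partial>M) = (\<integral>x. u x *\<^sub>R g (\<phi> x) \<partial>M)"
      by simp
    also have "\<dots> = (\<integral>x. enn2real (q x) *\<^sub>R g x \<partial>M)"
      unfolding q_def
      by (rule integral_pushforward) (use q_fin u0 in \<open>auto simp: u_def q_def\<close>)
    also have "\<dots> = (\<integral>x. g x * cnj (K x) \<partial>M)"
      by (simp add: K_def scaleR_conv_of_real mult.commute)
    finally show ?thesis .
  qed
  with K have "is_adj (\<lambda>x. sgn (w x) * complex_of_real (s x)) K"
    by (simp add: is_adj_def)
  then show ?thesis by blast
qed

text \<open>On \<open>{w \<noteq> 0}\<close> every \<open>f\<close> is a linear combination, with coefficients \<open>1, -1, \<i>, -\<i>\<close>, of four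
  functions with the phase of \<open>w\<close>: split the function \<open>z\<close> below into the positive and negative parts
  of its real and imaginary parts.\<close>

lemma is_adj_exists:
  assumes f: "f \<in> square_integrable M"
  shows "\<exists>K. is_adj f K"
proof -
  note [measurable] = f
  define z where "z x = cnj (sgn (w x)) * f x" for x
  have [measurable]: "sgn \<in> borel_measurable (borel :: complex measure)"
    by (simp add: sgn_div_norm[abs_def])
  have [measurable]: "z \<in> borel_measurable M"
    unfolding z_def[abs_def] by measurable
  have zf: "cmod (z x) \<le> cmod (f x)" for x
    by (simp add: z_def norm_mult norm_sgn mult_left_le_one_le)
  have part: "(\<lambda>x. sgn (w x) * complex_of_real (r (z x))) \<in> square_integrable M \<and>
      (\<exists>K. is_adj (\<lambda>x. sgn (w x) * complex_of_real (r (z x))) K)"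
    if [measurable]: "r \<in> borel_measurable borel" and r: "\<And>c. 0 \<le> r c" "\<And>c. r c \<le> cmod c" for r
  proof
    have le: "\<bar>r (z x)\<bar> \<le> cmod (f x)" for x
      using r zf by (metis abs_of_nonneg order_trans)
    have "(\<lambda>x. complex_of_real (r (z x))) \<in> square_integrable M"
      by (rule square_integrable_bound[OF f, where c = 1]) (use le in auto)
    then show "\<exists>K. is_adj (\<lambda>x. sgn (w x) * complex_of_real (r (z x))) K"
      by (intro is_adj_exists_in_phase) (use r in auto)
    show "(\<lambda>x. sgn (w x) * complex_of_real (r (z x))) \<in> square_integrable M"
      by (rule square_integrable_bound[OF f, where c = 1])
         (use le in \<open>auto simp: norm_mult norm_sgn\<close>)
  qed
  define r1 r2 r3 r4 :: "complex \<Rightarrow> real"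
    where "r1 c = max 0 (Re c)" and "r2 c = max 0 (- Re c)"
      and "r3 c = max 0 (Im c)" and "r4 c = max 0 (- Im c)" for c
  let ?p = "\<lambda>r x. sgn (w x) * complex_of_real (r (z x))"
  have p1: "?p r1 \<in> square_integrable M \<and> (\<exists>K. is_adj (?p r1) K)"
    by (rule part) (auto simp: r1_def[abs_def] complex_Re_le_cmod)
  have p2: "?p r2 \<in> square_integrable M \<and> (\<exists>K. is_adj (?p r2) K)"
    by (rule part) (use abs_Re_le_cmod abs_le_iff in \<open>auto simp: r2_def[abs_def]\<close>)
  have p3: "?p r3 \<in> square_integrable M \<and> (\<exists>K. is_adj (?p r3) K)"
    by (rule part) (use abs_Im_le_cmod abs_le_iff in \<open>auto simp: r3_def[abs_def]\<close>)
  have p4: "?p r4 \<in> square_integrable M \<and> (\<exists>K. is_adj (?p r4) K)"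
    by (rule part) (use abs_Im_le_cmod abs_le_iff in \<open>auto simp: r4_def[abs_def]\<close>)
  obtain K1 K2 K3 K4 where K: "is_adj (?p r1) K1" "is_adj (?p r2) K2" "is_adj (?p r3) K3" "is_adj (?p r4) K4"
    using p1 p2 p3 p4 by blast
  define f' where "f' x = (?p r1 x + (-1) * ?p r2 x) + \<i> * (?p r3 x + (-1) * ?p r4 x)" for x
  have "is_adj f' (\<lambda>x. (K1 x + (-1) * K2 x) + \<i> * (K3 x + (-1) * K4 x))"
    unfolding f'_def[abs_def]
    by (intro is_adj_add is_adj_cmult square_integrable_add square_integrable_cmult K)
       (use p1 p2 p3 p4 in auto)
  moreover have "f' \<in> square_integrable M"
    unfolding f'_def[abs_def]
    by (intro square_integrable_add square_integrable_cmult) (use p1 p2 p3 p4 in auto)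
  moreover have "f' x = f x" if "w x \<noteq> 0" for x
  proof -
    have "f' x = sgn (w x) * z x"
      by (simp add: f'_def r1_def r2_def r3_def r4_def complex_eq_iff max_def algebra_simps)
    also have "\<dots> = (sgn (w x) * cnj (sgn (w x))) * f x"
      by (simp add: z_def)
    also have "sgn (w x) * cnj (sgn (w x)) = 1"
      using that by (simp add: complex_norm_square[symmetric] norm_sgn)
    finally show ?thesis by simp
  qed
  ultimately show ?thesis
    using is_adj_cong[of f' _ f] f by auto
qed

lemma l2_adjoint_class:
  assumes f: "f \<in> square_integrable M" and K: "is_adj f K"
  shows "l2_adjoint M (wcomp_op M \<phi> w) (l2_class M f) = Some (l2_class M K)"
proof -
  let ?P = "\<lambda>L. L \<in> L2 M \<and> (\<forall>F\<in>dom (wcomp_op M \<phi> w).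
    l2_inner M (the (wcomp_op M \<phi> w F)) (l2_class M f) = l2_inner M F L)"
  have dom: "dom (wcomp_op M \<phi> w) = L2 M"
    using bounded by (simp add: bounded_on_L2_def)
  have iff: "?P (l2_class M L) \<longleftrightarrow> is_adj f L" if L: "L \<in> square_integrable M" for L
  proof -
    have "(\<forall>F\<in>L2 M. l2_inner M (the (wcomp_op M \<phi> w F)) (l2_class M f) = l2_inner M F (l2_class M L))
      \<longleftrightarrow> (\<forall>g\<in>square_integrable M. l2_inner M (the (wcomp_op M \<phi> w (l2_class M g))) (l2_class M f)
            = l2_inner M (l2_class M g) (l2_class M L))"
      using L2_class L2_cases by metis
    then show ?thesis
      using L f by (simp add: dom L2_class is_adj_def wcomp_op_T l2_inner_class)
  qed
  have K2: "K \<in> square_integrable M" using K by (simp add: is_adj_def)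
  have "(THE L. ?P L) = l2_class M K"
  proof (rule the_equality)
    show "?P (l2_class M K)" using iff[OF K2] K by simp
    fix L' assume P: "?P L'"
    then obtain L where L: "L \<in> square_integrable M" "L' = l2_class M L"
      using L2_cases by metis
    then have "is_adj f L" using P iff by blast
    then show "L' = l2_class M K"
      using is_adj_unique[OF _ K] L K2 by (simp add: l2_class_eq_iff)
  qed
  moreover have "\<exists>L\<in>L2 M. \<forall>F\<in>dom (wcomp_op M \<phi> w).
      l2_inner M (the (wcomp_op M \<phi> w F)) (l2_class M f) = l2_inner M F L"
    using iff[OF K2] K by blast
  ultimately show ?thesis
    using L2_class[OF f] by (simp add: l2_adjoint_def)
qed

definition T_adj :: "('a \<Rightarrow> complex) \<Rightarrow> 'a \<Rightarrow> complex" where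
  "T_adj f = (SOME K. is_adj f K)"

lemma T_adj_is_adj: "f \<in> square_integrable M \<Longrightarrow> is_adj f (T_adj f)"
  unfolding T_adj_def using is_adj_exists by (rule someI_ex)

lemma T_adj_square_integrable [simp, intro]: "f \<in> square_integrable M \<Longrightarrow> T_adj f \<in> square_integrable M"
  using T_adj_is_adj by (simp add: is_adj_def)

lemma T_adj_unique:
  "f \<in> square_integrable M \<Longrightarrow> is_adj f K \<Longrightarrow> AE x in M. T_adj f x = K x"
  using is_adj_unique T_adj_is_adj by blast


section \<open>Weak centeredness\<close>

lemma T_cong:
  "AE x in M. f x = f' x \<Longrightarrow> AE x in M. T f x = T f' x"
  by (drule AE_comp_symbol, erule eventually_mono) (auto simp: wcomp_fun_def)

lemma T_adj_cong:
  assumes f: "f \<in> square_integrable M" "f' \<in> square_integrable M" and eq: "AE x in M. f x = f' x"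
  shows "AE x in M. T_adj f x = T_adj f' x"
proof (rule T_adj_unique[OF f(1)])
  show "is_adj f (T_adj f')"
    by (rule is_adj_cong[OF T_adj_is_adj[OF f(2)]])
       (use f eq in \<open>auto dest: square_integrable_measurable elim!: eventually_mono\<close>)
qed

abbreviation times_h :: "('a \<Rightarrow> complex) \<Rightarrow> 'a \<Rightarrow> complex" where
  "times_h f \<equiv> (\<lambda>x. complex_of_real (hr x) * f x)"

lemma times_h_square_integrable [simp, intro]:
  assumes f: "f \<in> square_integrable M"
  shows "times_h f \<in> square_integrable M"
proof -
  note [measurable] = f
  obtain C :: real where "AE x in M. hr x \<le> C"
    using hr_bounded by metis
  then have "AE x in M. cmod (times_h f x) \<le> C * cmod (f x)"
    by eventually_elim (auto simp: norm_mult intro: mult_right_mono)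
  then show ?thesis
    by (intro square_integrable_bound[OF f]) auto
qed

text \<open>\<open>T\<^sup>*T\<close> is multiplication by \<open>h\<close>, because \<open>\<langle>Tg, Tf\<rangle>\<close> is the \<open>\<mu>\<^sub>w\<close>-integral of a function of \<open>\<phi>\<close>.\<close>

lemma is_adj_T:
  assumes f: "f \<in> square_integrable M"
  shows "is_adj (T f) (times_h f)"
  unfolding is_adj_def
proof (intro conjI ballI)
  show "times_h f \<in> square_integrable M" using f by blast
  fix g assume g: "g \<in> square_integrable M"
  note [measurable] = f g
  have "T g x * cnj (T f x) = (cmod (w x))\<^sup>2 *\<^sub>R (g (\<phi> x) * cnj (f (\<phi> x)))" for x
    unfolding scaleR_conv_of_real complex_norm_square by (simp add: wcomp_fun_def mult_ac)
  then have "(\<integral>x. T g x * cnj (T f x) \<partial>M) = (\<integral>x. (cmod (w x))\<^sup>2 *\<^sub>R (g (\<phi> x) * cnj (f (\<phi> x))) \<partial>M)"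
    by simp
  also have "\<dots> = (\<integral>x. hr x *\<^sub>R (g x * cnj (f x)) \<partial>M)"
    unfolding hr_def h_deriv_pushforward
    by (rule integral_pushforward)
       (use h_eq_hr in \<open>auto simp: hr_def h_deriv_pushforward\<close>)
  also have "\<dots> = (\<integral>x. g x * cnj (times_h f x) \<partial>M)"
    by (simp add: scaleR_conv_of_real mult_ac)
  finally show "(\<integral>x. T g x * cnj (T f x) \<partial>M) = (\<integral>x. g x * cnj (times_h f x) \<partial>M)" .
qed

text \<open>Both sides of \<open>TT\<^sup>*T\<^sup>*T = T\<^sup>*TTT\<^sup>*\<close> contain \<open>T\<^sup>*T\<close>, once as the inner and once as the outer
  factor; replacing it by multiplication by \<open>h\<close> leaves \<open>w \<cdot> T\<^sup>*(hf) \<circ> \<phi> = h w \<cdot> T\<^sup>*f \<circ> \<phi>\<close>.\<close>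

lemma weakly_centered_iff:
  "weakly_centered M (wcomp_op M \<phi> w) \<longleftrightarrow>
    (\<forall>f\<in>square_integrable M. AE x in M. w x \<noteq> 0 \<longrightarrow>
      T_adj (times_h f) (\<phi> x) = complex_of_real (hr x) * T_adj f (\<phi> x))"
proof -
  let ?C = "wcomp_op M \<phi> w"
  let ?A = "l2_adjoint M ?C"
  let ?L = "?C \<circ>\<^sub>m ?A \<circ>\<^sub>m ?A \<circ>\<^sub>m ?C" and ?R = "?A \<circ>\<^sub>m ?C \<circ>\<^sub>m ?C \<circ>\<^sub>m ?A"
  have A: "?A (l2_class M f) = Some (l2_class M (T_adj f))" if "f \<in> square_integrable M" for f
    using l2_adjoint_class[OF that T_adj_is_adj[OF that]] .
  have eq: "?L (l2_class M f) = ?R (l2_class M f) \<longleftrightarrow> (AE x in M. w x \<noteq> 0 \<longrightarrow>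
      T_adj (times_h f) (\<phi> x) = complex_of_real (hr x) * T_adj f (\<phi> x))"
    if f: "f \<in> square_integrable M" for f
  proof -
    have "?L (l2_class M f) = Some (l2_class M (T (T_adj (T_adj (T f)))))"
      using f by (simp add: map_comp_def A wcomp_op_T)
    also have "l2_class M (T (T_adj (T_adj (T f)))) = l2_class M (T (T_adj (times_h f)))"
      using f by (intro l2_class_eq T_cong T_adj_cong T_adj_unique is_adj_T) auto
    finally have L: "?L (l2_class M f) = Some (l2_class M (T (T_adj (times_h f))))" .
    have "?R (l2_class M f) = Some (l2_class M (T_adj (T (T (T_adj f)))))"
      using f by (simp add: map_comp_def A wcomp_op_T)
    also have "l2_class M (T_adj (T (T (T_adj f)))) = l2_class M (times_h (T (T_adj f)))"
      using f by (intro l2_class_eq T_adj_unique is_adj_T) auto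
    finally have R: "?R (l2_class M f) = Some (l2_class M (times_h (T (T_adj f))))" .
    have "?L (l2_class M f) = ?R (l2_class M f) \<longleftrightarrow>
        (AE x in M. T (T_adj (times_h f)) x = times_h (T (T_adj f)) x)"
      unfolding L R option.inject using f by (intro l2_class_eq_iff) auto
    also have "\<dots> \<longleftrightarrow> (AE x in M. w x \<noteq> 0 \<longrightarrow>
        T_adj (times_h f) (\<phi> x) = complex_of_real (hr x) * T_adj f (\<phi> x))"
      by (rule arg_cong[where f = "almost_everywhere M"], rule ext) (auto simp: wcomp_fun_def)
    finally show ?thesis .
  qed
  have none: "?L F = ?R F" if "F \<notin> L2 M" for F
    using that by (simp add: map_comp_def wcomp_op_def l2_adjoint_def)
  have "weakly_centered M ?C \<longleftrightarrow> (\<forall>F. ?L F = ?R F)"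
    by (simp add: weakly_centered_def fun_eq_iff)
  also have "\<dots> \<longleftrightarrow> (\<forall>f\<in>square_integrable M. ?L (l2_class M f) = ?R (l2_class M f))"
    using none L2_cases by metis
  finally show ?thesis using eq by simp
qed

text \<open>The common content of the three conditions.\<close>

definition h_factors_through_symbol :: bool where
  "h_factors_through_symbol \<longleftrightarrow> (\<exists>k\<in>borel_measurable M. AE x in M. w x \<noteq> 0 \<longrightarrow> hr x = (k (\<phi> x) :: real))"

text \<open>As \<open>0 \<le> h \<le> C\<close>, the factor \<open>k\<close> may be clipped to \<open>[0, C]\<close>; multiplication by it then preserves
  \<open>L\<^sup>2\<close>.\<close>

lemma h_factors_bounded:
  assumes h_factors_through_symbol
  obtains k :: "'a \<Rightarrow> real" and C where "k \<in> borel_measurable M" "\<And>x. 0 \<le> k x" "\<And>x. k x \<le> C"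
    "AE x in M. w x \<noteq> 0 \<longrightarrow> hr x = k (\<phi> x)"
proof -
  obtain k :: "'a \<Rightarrow> real" where k: "k \<in> borel_measurable M" "AE x in M. w x \<noteq> 0 \<longrightarrow> hr x = k (\<phi> x)"
    using assms by (auto simp: h_factors_through_symbol_def)
  obtain C :: real where C: "C > 0" "AE x in M. hr x \<le> C"
    using hr_bounded by metis
  show ?thesis
  proof (rule that[of "\<lambda>x. max 0 (min (k x) C)" C])
    show "(\<lambda>x. max 0 (min (k x) C)) \<in> borel_measurable M" using k(1) by measurable
    show "AE x in M. w x \<noteq> 0 \<longrightarrow> hr x = max 0 (min (k (\<phi> x)) C)"
      using k(2) C(2)
    proof eventually_elim
      case (elim x)
      show ?case
      proof
        assume "w x \<noteq> 0"
        then have "k (\<phi> x) = hr x" using elim by simp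
        then show "hr x = max 0 (min (k (\<phi> x)) C)" using elim(2) by simp
      qed
    qed
  qed (use C(1) in auto)
qed

text \<open>For \<open>f = Tg\<close> the commutation relation becomes \<open>K \<circ> \<phi> = h \<cdot> (h g) \<circ> \<phi>\<close> with \<open>K = T\<^sup>*(h Tg)\<close>, and
  \<open>(h g) \<circ> \<phi>\<close> does not vanish on \<open>{w \<noteq> 0}\<close>.\<close>

lemma weakly_centered_imp_factors:
  assumes "weakly_centered M (wcomp_op M \<phi> w)"
  shows h_factors_through_symbol
proof -
  obtain g :: "'a \<Rightarrow> real" where g: "g \<in> borel_measurable M" "\<And>x. g x > 0"
      "(\<lambda>x. complex_of_real (g x)) \<in> square_integrable M" (is "?g \<in> _")
    using ex_positive_square_integrable by metis
  define K where "K = T_adj (times_h (T ?g))"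
  have [measurable]: "K \<in> borel_measurable M"
    using g(3) by (simp add: K_def square_integrable_measurable)
  define k where "k x = cmod (K x / complex_of_real (hr x * g x))" for x
  note [measurable] = g(1)
  have "k \<in> borel_measurable M" unfolding k_def[abs_def] by measurable
  moreover have "AE x in M. w x \<noteq> 0 \<longrightarrow> K (\<phi> x) = complex_of_real (hr x) * T_adj (T ?g) (\<phi> x)"
    using assms g(3) by (simp add: weakly_centered_iff K_def)
  moreover have "AE x in M. T_adj (T ?g) x = complex_of_real (hr x * g x)"
    using T_adj_unique[OF _ is_adj_T[OF g(3)]] g(3) by simp
  then have "AE x in M. w x \<noteq> 0 \<longrightarrow> T_adj (T ?g) (\<phi> x) = complex_of_real (hr (\<phi> x) * g (\<phi> x))"
    by (rule AE_comp_symbol)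
  ultimately have "AE x in M. w x \<noteq> 0 \<longrightarrow> hr x = k (\<phi> x)"
    using hr_comp_symbol_pos
    by (elim AE_mp, intro AE_I2) (use g(2) in \<open>auto simp: k_def norm_mult norm_divide less_imp_neq[symmetric]\<close>)
  with \<open>k \<in> borel_measurable M\<close> show ?thesis by (auto simp: h_factors_through_symbol_def)
qed

text \<open>The relation to be shown is \<open>T\<^sup>*(hf) = k \<cdot> T\<^sup>*f\<close>, composed with \<open>\<phi>\<close>.\<close>

lemma factors_imp_weakly_centered:
  assumes h_factors_through_symbol
  shows "weakly_centered M (wcomp_op M \<phi> w)"
  unfolding weakly_centered_iff
proof
  fix f assume f: "f \<in> square_integrable M"
  obtain k :: "'a \<Rightarrow> real" and C where k: "k \<in> borel_measurable M" "\<And>x. 0 \<le> k x" "\<And>x. k x \<le> C"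
    "AE x in M. w x \<noteq> 0 \<longrightarrow> hr x = k (\<phi> x)"
    using h_factors_bounded[OF assms] by metis
  note [measurable] = k(1) f T_adj_square_integrable[OF f]
  let ?k = "\<lambda>u x. complex_of_real (k x) * u x"
  have k2: "?k u \<in> square_integrable M" if u: "u \<in> square_integrable M" for u
    by (rule square_integrable_bound[OF u, where c = C])
       (use k(1-3) u in \<open>auto simp: norm_mult intro!: AE_I2 mult_right_mono dest: square_integrable_measurable\<close>)
  \<comment> \<open>Multiplication by \<open>h\<close> in the range of \<open>T\<close> is multiplication by \<open>k\<close> in its argument.\<close>
  have "is_adj (times_h f) (?k (T_adj f))"
    unfolding is_adj_def
  proof (intro conjI ballI)
    show "?k (T_adj f) \<in> square_integrable M" using k2 f by auto
    fix g assume g: "g \<in> square_integrable M"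
    note [measurable] = g k2[OF g] T_square_integrable[OF g] T_square_integrable[OF k2[OF g]]
    have "(\<integral>x. T g x * cnj (times_h f x) \<partial>M) = (\<integral>x. T (?k g) x * cnj (f x) \<partial>M)"
    proof (rule integral_cong_AE)
      show "AE x in M. T g x * cnj (times_h f x) = T (?k g) x * cnj (f x)"
        using k(4) by eventually_elim (auto simp: wcomp_fun_def)
    qed measurable
    also have "\<dots> = (\<integral>x. ?k g x * cnj (T_adj f x) \<partial>M)"
      using T_adj_is_adj[OF f] k2[OF g] by (simp add: is_adj_def)
    also have "\<dots> = (\<integral>x. g x * cnj (?k (T_adj f) x) \<partial>M)"
      by (simp add: mult_ac)
    finally show "(\<integral>x. T g x * cnj (times_h f x) \<partial>M) = (\<integral>x. g x * cnj (?k (T_adj f) x) \<partial>M)" .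
  qed
  then have "AE x in M. T_adj (times_h f) x = ?k (T_adj f) x"
    using f by (intro T_adj_unique) auto
  then have "AE x in M. w x \<noteq> 0 \<longrightarrow> T_adj (times_h f) (\<phi> x) = ?k (T_adj f) (\<phi> x)"
    by (rule AE_comp_symbol)
  then show "AE x in M. w x \<noteq> 0 \<longrightarrow> T_adj (times_h f) (\<phi> x) = complex_of_real (hr x) * T_adj f (\<phi> x)"
    using k(4) by eventually_elim auto
qed

section \<open>Conditional expectation\<close>

abbreviation symbol_algebra :: "'a measure" where
  "symbol_algebra \<equiv> vimage_algebra (space M) \<phi> M"

lemma symbol_funcset: "\<phi> \<in> space M \<rightarrow> space M"
  using measurable_space[OF phi] by auto

lemma subalgebra_symbol: "subalgebra (weighted_measure M w) symbol_algebra"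
  unfolding subalgebra_def sets_vimage_algebra2[OF symbol_funcset]
  by (auto simp: weighted_measure_def)

text \<open>The image of \<open>\<mu>\<^sub>w\<close> under \<open>\<phi>\<close> has the finite density \<open>h\<close>, so it is \<open>\<sigma>\<close>-finite, and an exhaustion
  of it pulls back to one by sets of \<open>\<phi>\<inverse>(\<A>)\<close>.\<close>

lemma sigma_finite_symbol: "sigma_finite_subalgebra (weighted_measure M w) symbol_algebra"
proof (rule sigma_finite_subalgebra.intro[OF subalgebra_symbol])
  let ?R = "restr_to_subalg (weighted_measure M w) symbol_algebra"
  have space_R: "space ?R = space M"
    by (simp add: space_restr_to_subalg weighted_measure_def)
  have phi_R: "\<phi> \<in> measurable symbol_algebra M"
    by (rule measurable_vimage_algebra1[OF symbol_funcset])
  then have phi_R' [measurable]: "\<phi> \<in> measurable ?R M"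
    using measurable_cong_sets[OF sets_restr_to_subalg[OF subalgebra_symbol] refl] by blast
  have "density M h = distr ?R M \<phi>"
  proof (rule measure_eqI)
    fix A assume "A \<in> sets (density M h)"
    then have A [measurable]: "A \<in> sets M" by simp
    have "emeasure (density M h) A = emeasure (distr (weighted_measure M w) M \<phi>) A"
      unfolding h_deriv_pushforward weighted_measure_def by (subst density_pushforward) auto
    also have "\<dots> = emeasure (weighted_measure M w) (\<phi> -` A \<inter> space M)"
      by (subst emeasure_distr) (auto simp: weighted_measure_def)
    also have "\<dots> = emeasure ?R (\<phi> -` A \<inter> space M)"
      by (rule emeasure_restr_to_subalg[OF subalgebra_symbol, symmetric])
         (use A in \<open>auto simp: sets_vimage_algebra2[OF symbol_funcset]\<close>)
    also have "\<dots> = emeasure (distr ?R M \<phi>) A"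
      by (subst emeasure_distr) (auto simp: space_R)
    finally show "emeasure (density M h) A = emeasure (distr ?R M \<phi>) A" .
  qed simp
  moreover have "sigma_finite_measure (density M h)"
    using h_eq_hr by (subst sigma_finite_iff_density_finite) (auto elim!: eventually_mono simp: hr_def)
  ultimately show "sigma_finite_measure ?R"
    using phi_R' by (metis sigma_finite_measure_distr)
qed

lemma h_factors_iff_cond_exp:
  "h_factors_through_symbol \<longleftrightarrow> (AE x in weighted_measure M w. h x = cond_exp_w M \<phi> w h x)"
proof -
  interpret E: sigma_finite_subalgebra "weighted_measure M w" symbol_algebra
    by (rule sigma_finite_symbol)
  have h_W [measurable]: "h \<in> borel_measurable (weighted_measure M w)"
    unfolding weighted_measure_def by measurable
  show ?thesis
  proof
    assume h_factors_through_symbol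
    then obtain k :: "'a \<Rightarrow> real" where k: "k \<in> borel_measurable M" "AE x in M. w x \<noteq> 0 \<longrightarrow> hr x = k (\<phi> x)"
      by (auto simp: h_factors_through_symbol_def)
    define f where "f x = ennreal (k (\<phi> x))" for x
    have f [measurable]: "f \<in> borel_measurable symbol_algebra"
      unfolding f_def[abs_def] using k(1) measurable_vimage_algebra1[OF symbol_funcset]
      by measurable
    have hf: "AE x in weighted_measure M w. h x = f x"
      unfolding AE_weighted using k(2) h_eq_hr by eventually_elim (auto simp: f_def)
    have "AE x in weighted_measure M w. cond_exp_w M \<phi> w h x = nn_cond_exp (weighted_measure M w) symbol_algebra f x"
      unfolding cond_exp_w_def
      by (rule E.nn_cond_exp_cong[OF hf]) (use measurable_from_subalg[OF subalgebra_symbol f] in auto)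
    with hf E.nn_cond_exp_F_meas[OF f]
    show "AE x in weighted_measure M w. h x = cond_exp_w M \<phi> w h x"
      by eventually_elim simp
  next
    assume AE: "AE x in weighted_measure M w. h x = cond_exp_w M \<phi> w h x"
    have "cond_exp_w M \<phi> w h \<in> borel_measurable symbol_algebra"
      unfolding cond_exp_w_def by (rule borel_measurable_nn_cond_exp)
    then obtain k where k: "k \<in> borel_measurable M" "\<forall>x\<in>space M. cond_exp_w M \<phi> w h x = k (\<phi> x)"
      using borel_measurable_vimage_algebra_factor[OF _ symbol_funcset] by blast
    have "AE x in M. w x \<noteq> 0 \<longrightarrow> hr x = enn2real (k (\<phi> x))"
      using AE[unfolded AE_weighted] AE_space by eventually_elim (use k(2) in \<open>auto simp: hr_def\<close>)
    moreover have "(\<lambda>x. enn2real (k x)) \<in> borel_measurable M" using k(1) by measurable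
    ultimately show h_factors_through_symbol unfolding h_factors_through_symbol_def by (intro bexI) 
  qed
qed

section \<open>Equality of the two weighted composition operators\<close>

abbreviation H :: "'a \<Rightarrow> ennreal" where "H \<equiv> h_deriv M \<phi> (w_half M \<phi> w)"

lemma norm_w_half: "(cmod (w_half M \<phi> w x))\<^sup>2 = (cmod (w x))\<^sup>2 * sqrt (hr x / hr (\<phi> x))"
proof -
  let ?a = "hr x / hr (\<phi> x)"
  have "(?a powr (1 / 4))\<^sup>2 = ?a powr (1 / 2)"
    by (simp add: power2_eq_square powr_add[symmetric])
  also have "\<dots> = sqrt ?a"
    by (rule powr_half_sqrt) simp
  finally show ?thesis
    by (simp add: w_half_def norm_mult power_mult_distrib norm_of_real hr_def)
qed

lemma w_half_measurable [measurable]: "w_half M \<phi> w \<in> borel_measurable M"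
  unfolding w_half_def by measurable

lemma nn_integral_w_half:
  assumes [measurable]: "g \<in> borel_measurable M"
  shows "(\<integral>\<^sup>+x. ennreal ((cmod (w_half M \<phi> w x))\<^sup>2) * g (\<phi> x) \<partial>M) = (\<integral>\<^sup>+x. H x * g x \<partial>M)"
  unfolding h_deriv_pushforward by (rule nn_integral_pushforward) (auto simp: w_half_def)

text \<open>The pointwise comparison of the two weights, with \<open>a = h x\<close>, \<open>b = h (\<phi> x)\<close> and \<open>c = H (\<phi> x)\<close>,
  after division by \<open>w x\<close>. The case \<open>c = 0\<close> is included because the quotient is then \<open>0\<close>.\<close>

lemma half_weight_quotient_iff:
  fixes a b c :: real
  assumes "0 \<le> a" "0 < b" "0 \<le> c"
  shows "(if 0 < a then 1 else 0) / sqrt b = (a / b) powr (1 / 4) / sqrt c \<longleftrightarrow> (0 < a \<longrightarrow> c\<^sup>2 = a * b)"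
proof (cases "0 < a \<and> 0 < c")
  case True
  define r where "r = (a / b) powr (1 / 4)"
  have r: "r > 0" "r ^ 4 = a / b"
    using True assms by (auto simp: r_def powr_power)
  have "1 / sqrt b = r / sqrt c \<longleftrightarrow> sqrt c = r * sqrt b"
    using True assms by (auto simp: field_simps)
  also have "\<dots> \<longleftrightarrow> sqrt c ^ 4 = (r * sqrt b) ^ 4"
    using r True assms by (subst power_eq_iff_eq_base) auto
  also have "sqrt c ^ 4 = c\<^sup>2"
    using assms power_mult[of "sqrt c" 2 2] by simp
  also have "(r * sqrt b) ^ 4 = a * b"
    using assms power_mult[of "sqrt b" 2 2] r by (simp add: power_mult_distrib power2_eq_square)
  finally show ?thesis using True by (simp add: r_def)
next
  case False
  then show ?thesis using assms by auto
qed

text \<open>\<open>w_tilde M \<phi> w\<close> is the weight of the partial isometry in the polar decomposition of \<open>T\<close>, and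
  \<open>half_weight\<close> that for the Aluthge transform \<open>|T|\<^bsup>1/2\<^esup> U |T|\<^bsup>1/2\<^esup> = C\<^bsub>\<phi>,w_half\<^esub>\<close> of \<open>T = U |T|\<close>. Multiplication
  by the indicator function of \<open>{h > 0}\<close> is the projection onto the closure of the range of \<open>T\<^sup>*\<close>.\<close>

abbreviation polar_weight :: "'a \<Rightarrow> complex" where
  "polar_weight \<equiv> (\<lambda>x. indicator {y \<in> space M. h_deriv M \<phi> w y > 0} x * w_tilde M \<phi> w x)"

abbreviation half_weight :: "'a \<Rightarrow> complex" where
  "half_weight \<equiv> w_tilde M \<phi> (w_half M \<phi> w)"

lemma weights_measurable [measurable]:
  "polar_weight \<in> borel_measurable M" "half_weight \<in> borel_measurable M"
  unfolding w_tilde_def by measurable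

lemma weights_eq_iff:
  "(AE x in M. polar_weight x = half_weight x) \<longleftrightarrow>
   (AE x in M. w x \<noteq> 0 \<longrightarrow> hr x > 0 \<longrightarrow> (enn2real (H (\<phi> x)))\<^sup>2 = hr x * hr (\<phi> x))"
proof -
  have "AE x in M. polar_weight x = half_weight x \<longleftrightarrow>
    (w x \<noteq> 0 \<longrightarrow> hr x > 0 \<longrightarrow> (enn2real (H (\<phi> x)))\<^sup>2 = hr x * hr (\<phi> x))"
    using h_eq_hr hr_comp_symbol_pos AE_space
  proof eventually_elim
    case (elim x)
    let ?a = "hr x" and ?b = "hr (\<phi> x)" and ?c = "enn2real (H (\<phi> x))"
    have pos: "h x > 0 \<longleftrightarrow> ?a > 0"
      using elim(1) by (metis ennreal_less_zero_iff)
    show ?case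
    proof (cases "w x = 0")
      case True
      then show ?thesis by (simp add: w_tilde_def w_half_def)
    next
      case False
      have "polar_weight x = w x * complex_of_real ((if 0 < ?a then 1 else 0) / sqrt ?b)"
        using elim(3) pos by (simp add: w_tilde_def hr_def[symmetric] indicator_def)
      moreover have "half_weight x = w x * complex_of_real ((?a / ?b) powr (1 / 4) / sqrt ?c)"
        by (simp add: w_tilde_def w_half_def hr_def)
      ultimately have "polar_weight x = half_weight x \<longleftrightarrow>
          (if 0 < ?a then 1 else 0) / sqrt ?b = (?a / ?b) powr (1 / 4) / sqrt ?c"
        using False by (simp only: mult_cancel_left of_real_eq_iff) simp
      also have "\<dots> \<longleftrightarrow> (0 < ?a \<longrightarrow> ?c\<^sup>2 = ?a * ?b)"
        using elim(2) False by (intro half_weight_quotient_iff) auto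
      finally show ?thesis using False by simp
    qed
  qed
  then show ?thesis by (intro iffI; elim AE_mp) (auto elim!: eventually_mono)
qed

text \<open>The test function \<open>h\<^bsup>1/2\<^esup> g\<close> cancels the denominator of \<open>w_tilde\<close>, so it lies in the domain as \<open>Tg\<close>
  is square integrable, and it is nonzero at \<open>\<phi> x\<close> wherever \<open>w x \<noteq> 0\<close>.\<close>

lemma wcomp_op_eq_iff_weights_eq:
  "wcomp_op M \<phi> polar_weight = wcomp_op M \<phi> half_weight \<longleftrightarrow>
    (AE x in M. polar_weight x = half_weight x)"
proof
  assume eq: "wcomp_op M \<phi> polar_weight = wcomp_op M \<phi> half_weight"
  obtain g :: "'a \<Rightarrow> real" where g: "g \<in> borel_measurable M" "\<And>x. g x > 0"
      "(\<lambda>x. complex_of_real (g x)) \<in> square_integrable M" (is "?g \<in> _")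
    using ex_positive_square_integrable by metis
  note [measurable] = g(1)
  obtain C :: real where C: "C > 0" "AE x in M. hr x \<le> C"
    using hr_bounded by metis
  define f where "f x = complex_of_real (sqrt (hr x) * g x)" for x
  have [measurable]: "f \<in> borel_measurable M" unfolding f_def[abs_def] by measurable
  show "AE x in M. polar_weight x = half_weight x"
  proof (rule wcomp_op_eqD[OF eq])
    show "f \<in> square_integrable M"
    proof (rule square_integrable_bound[OF g(3), where c = "sqrt C"])
      show "AE x in M. cmod (f x) \<le> sqrt C * cmod (?g x)"
        using C(2) by eventually_elim (auto simp: f_def norm_mult intro: mult_right_mono)
    qed measurable
    show "wcomp_fun \<phi> polar_weight f \<in> square_integrable M"
    proof (rule square_integrable_bound[OF T_square_integrable[OF g(3)], where c = 1])
      show "AE x in M. cmod (wcomp_fun \<phi> polar_weight f x) \<le> 1 * cmod (T ?g x)"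
        using hr_comp_symbol_pos
        by eventually_elim
           (auto simp: wcomp_fun_def f_def norm_mult norm_divide w_tilde_def indicator_def hr_def[symmetric])
    qed (unfold wcomp_fun_def, measurable)
    show "AE x in M. w x \<noteq> 0 \<longrightarrow> f (\<phi> x) \<noteq> 0"
      using hr_comp_symbol_pos by eventually_elim (use g(2) in \<open>auto simp: f_def less_imp_neq[symmetric]\<close>)
  qed (auto simp: w_tilde_def w_half_def)
next
  assume "AE x in M. polar_weight x = half_weight x"
  then show "wcomp_op M \<phi> polar_weight = wcomp_op M \<phi> half_weight"
    by (intro wcomp_op_cong) measurable
qed

text \<open>If \<open>h = k \<circ> \<phi>\<close>, then \<open>|w\<^bsub>1/2\<^esub>|\<^sup>2 = |w|\<^sup>2 \<cdot> (k/h)\<^bsup>1/2\<^esup> \<circ> \<phi>\<close>, whose pushforward is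
  \<open>h (k/h)\<^bsup>1/2\<^esup> = (kh)\<^bsup>1/2\<^esup>\<close>.\<close>

lemma factors_imp_weights_eq:
  assumes h_factors_through_symbol
  shows "AE x in M. polar_weight x = half_weight x"
proof -
  obtain k :: "'a \<Rightarrow> real" and C where k: "k \<in> borel_measurable M" "\<And>x. 0 \<le> k x" "\<And>x. k x \<le> C"
    "AE x in M. w x \<noteq> 0 \<longrightarrow> hr x = k (\<phi> x)"
    using h_factors_bounded[OF assms] by metis
  note [measurable] = k(1)
  have "AE x in M. H x = ennreal (sqrt (k x * hr x))"
    unfolding h_deriv_pushforward
  proof (rule pushforward_unique)
    fix A assume A [measurable]: "A \<in> sets M"
    have "(\<integral>\<^sup>+x. ennreal ((cmod (w_half M \<phi> w x))\<^sup>2) * indicator A (\<phi> x) \<partial>M) =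
        (\<integral>\<^sup>+x. ennreal ((cmod (w x))\<^sup>2) * (ennreal (sqrt (k (\<phi> x) / hr (\<phi> x))) * indicator A (\<phi> x)) \<partial>M)"
    proof (rule nn_integral_cong_AE)
      show "AE x in M. ennreal ((cmod (w_half M \<phi> w x))\<^sup>2) * indicator A (\<phi> x) =
          ennreal ((cmod (w x))\<^sup>2) * (ennreal (sqrt (k (\<phi> x) / hr (\<phi> x))) * indicator A (\<phi> x))"
        using k(4)
      proof eventually_elim
        case (elim x)
        then show ?case
          by (cases "w x = 0") (auto simp: norm_w_half ennreal_mult mult.assoc k(2))
      qed
    qed
    also have "\<dots> = (\<integral>\<^sup>+x. ennreal (hr x) * (ennreal (sqrt (k x / hr x)) * indicator A x) \<partial>M)"
      by (rule nn_integral_weight_hr) measurable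
    also have "\<dots> = (\<integral>\<^sup>+x. ennreal (sqrt (k x * hr x)) * indicator A x \<partial>M)"
    proof (rule nn_integral_cong)
      fix x
      have "hr x * sqrt (k x / hr x) = sqrt (k x * hr x)"
      proof -
        have "hr x * sqrt (k x / hr x) = sqrt (k x) * (hr x / sqrt (hr x))"
          by (simp add: real_sqrt_divide)
        then show ?thesis by (simp add: real_div_sqrt real_sqrt_mult)
      qed
      then have "ennreal (hr x) * ennreal (sqrt (k x / hr x)) = ennreal (sqrt (k x * hr x))"
        by (simp add: ennreal_mult[symmetric] k(2))
      then show "ennreal (hr x) * (ennreal (sqrt (k x / hr x)) * indicator A x) =
          ennreal (sqrt (k x * hr x)) * indicator A x"
        by (simp add: mult.assoc[symmetric])
    qed
    finally show "(\<integral>\<^sup>+x. ennreal ((cmod (w_half M \<phi> w x))\<^sup>2) * indicator A (\<phi> x) \<partial>M) =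
        (\<integral>\<^sup>+x. ennreal (sqrt (k x * hr x)) * indicator A x \<partial>M)" .
  qed measurable
  then have "AE x in M. w x \<noteq> 0 \<longrightarrow> H (\<phi> x) = ennreal (sqrt (k (\<phi> x) * hr (\<phi> x)))"
    by (rule AE_comp_symbol)
  then show ?thesis
    unfolding weights_eq_iff using k(4)
    by eventually_elim (auto simp: k(2))
qed

text \<open>Where \<open>h > 0\<close> the assumption gives \<open>h\<^bsup>1/2\<^esup> = p \<circ> \<phi>\<close>, and where \<open>h = 0\<close> it gives nothing. But the weighted
  integrals of the two sides agree, so \<open>p \<circ> \<phi>\<close> has no mass left on \<open>{h = 0}\<close>.\<close>

lemma weights_eq_imp_factors:
  assumes "AE x in M. polar_weight x = half_weight x"
  shows h_factors_through_symbol
proof -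
  have HH: "AE x in M. w x \<noteq> 0 \<longrightarrow> hr x > 0 \<longrightarrow> (enn2real (H (\<phi> x)))\<^sup>2 = hr x * hr (\<phi> x)"
    using assms unfolding weights_eq_iff .
  obtain g :: "'a \<Rightarrow> real" where g: "g \<in> borel_measurable M" "\<And>x. g x > 0"
      "(\<lambda>x. complex_of_real (g x)) \<in> square_integrable M" (is "?g \<in> _")
    using ex_positive_square_integrable by metis
  note [measurable] = g(1)
  obtain C :: real where C: "C > 0" "AE x in M. hr x \<le> C"
    using hr_bounded by metis
  define p where "p x = enn2real (H x) / sqrt (hr x)" for x
  have [measurable]: "p \<in> borel_measurable M" unfolding p_def[abs_def] by measurable
  have p0: "0 \<le> p x" for x by (simp add: p_def)
  have p_eq: "AE x in M. w x \<noteq> 0 \<longrightarrow> hr x > 0 \<longrightarrow> p (\<phi> x) = sqrt (hr x)"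
    using HH hr_comp_symbol_pos
  proof eventually_elim
    case (elim x)
    show ?case
    proof (intro impI)
      assume *: "w x \<noteq> 0" "hr x > 0"
      then have "enn2real (H (\<phi> x)) = sqrt (hr x * hr (\<phi> x))"
        using elim by (metis enn2real_nonneg real_sqrt_unique)
      then show "p (\<phi> x) = sqrt (hr x)"
        using elim * by (simp add: p_def real_sqrt_mult)
    qed
  qed
  let ?u = "\<lambda>x. ennreal ((cmod (T ?g x))\<^sup>2) * ennreal (sqrt (hr x))"
  let ?v = "\<lambda>x. ennreal ((cmod (T ?g x))\<^sup>2) * ennreal (p (\<phi> x))"
  note [measurable] = T_square_integrable[OF g(3)]
  have "AE x in M. ?u x = ?v x"
  proof (rule nn_integral_antimono_imp_AE_eq)
    show "AE x in M. ?u x \<le> ?v x"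
      using p_eq
    proof eventually_elim
      case (elim x)
      then show ?case
        using hr_nonneg[of x] p0[of "\<phi> x"]
        by (cases "w x = 0"; cases "hr x = 0") (auto simp: wcomp_fun_def less_le)
    qed
    have "(\<integral>\<^sup>+x. ?v x \<partial>M) = (\<integral>\<^sup>+x. ennreal ((cmod (w x))\<^sup>2) * (ennreal ((g (\<phi> x))\<^sup>2) * ennreal (p (\<phi> x))) \<partial>M)"
      by (simp add: T_norm_sq norm_of_real mult.assoc)
    also have "\<dots> = (\<integral>\<^sup>+x. ennreal (hr x) * (ennreal ((g x)\<^sup>2) * ennreal (p x)) \<partial>M)"
      by (rule nn_integral_weight_hr) measurable
    also have "\<dots> \<le> (\<integral>\<^sup>+x. H x * (ennreal (sqrt (hr x)) * ennreal ((g x)\<^sup>2)) \<partial>M)"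
    proof (rule nn_integral_mono)
      fix x
      have "hr x * p x = enn2real (H x) * sqrt (hr x)"
        using real_sqrt_mult_self[of "hr x"] by (cases "hr x = 0") (auto simp: p_def field_simps)
      then have "hr x * ((g x)\<^sup>2 * p x) = enn2real (H x) * (sqrt (hr x) * (g x)\<^sup>2)"
        by (simp add: mult_ac) 
      then have "ennreal (hr x) * (ennreal ((g x)\<^sup>2) * ennreal (p x)) =
          ennreal (enn2real (H x)) * (ennreal (sqrt (hr x)) * ennreal ((g x)\<^sup>2))"
        using p0[of x] by (simp add: ennreal_mult[symmetric])
      also have "\<dots> \<le> H x * (ennreal (sqrt (hr x)) * ennreal ((g x)\<^sup>2))"
        by (intro mult_right_mono) (cases "H x", auto)
      finally show "ennreal (hr x) * (ennreal ((g x)\<^sup>2) * ennreal (p x))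
          \<le> H x * (ennreal (sqrt (hr x)) * ennreal ((g x)\<^sup>2))" .
    qed
    also have "\<dots> = (\<integral>\<^sup>+x. ennreal ((cmod (w_half M \<phi> w x))\<^sup>2) * (ennreal (sqrt (hr (\<phi> x))) * ennreal ((g (\<phi> x))\<^sup>2)) \<partial>M)"
      by (rule nn_integral_w_half[symmetric]) measurable
    also have "\<dots> = (\<integral>\<^sup>+x. ?u x \<partial>M)"
    proof (rule nn_integral_cong_AE)
      show "AE x in M. ennreal ((cmod (w_half M \<phi> w x))\<^sup>2) * (ennreal (sqrt (hr (\<phi> x))) * ennreal ((g (\<phi> x))\<^sup>2)) = ?u x"
        using hr_comp_symbol_pos
      proof eventually_elim
        case (elim x)
        show ?case
        proof (cases "w x = 0")
          case False
          then have "sqrt (hr x / hr (\<phi> x)) * sqrt (hr (\<phi> x)) = sqrt (hr x)"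
            using elim by (simp add: real_sqrt_divide)
          then have "(cmod (w_half M \<phi> w x))\<^sup>2 * (sqrt (hr (\<phi> x)) * (g (\<phi> x))\<^sup>2) =
              (cmod (w x))\<^sup>2 * (g (\<phi> x))\<^sup>2 * sqrt (hr x)"
            by (simp add: norm_w_half mult_ac)
          then show ?thesis
            by (simp add: T_norm_sq norm_of_real ennreal_mult[symmetric])
        qed (simp add: norm_w_half T_norm_sq)
      qed
    qed
    finally show "(\<integral>\<^sup>+x. ?v x \<partial>M) \<le> (\<integral>\<^sup>+x. ?u x \<partial>M)" .
    have "(\<integral>\<^sup>+x. ?u x \<partial>M) \<le> (\<integral>\<^sup>+x. ennreal ((cmod (T ?g x))\<^sup>2) * ennreal (sqrt C) \<partial>M)"
      by (rule nn_integral_mono_AE) (use C(2) in \<open>auto elim!: eventually_mono intro!: mult_left_mono ennreal_leI\<close>)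
    also have "\<dots> < \<infinity>"
      using square_integrable_nn_integral[OF T_square_integrable[OF g(3)]]
      by (simp add: nn_integral_multc ennreal_mult_less_top)
    finally show "(\<integral>\<^sup>+x. ?u x \<partial>M) < \<infinity>" .
  qed measurable
  then have "AE x in M. w x \<noteq> 0 \<longrightarrow> hr x = (p (\<phi> x))\<^sup>2"
  proof eventually_elim
    case (elim x)
    show ?case
    proof
      assume "w x \<noteq> 0"
      then have pos: "(cmod (T ?g x))\<^sup>2 > 0"
        using g(2)[of "\<phi> x"] by (simp add: wcomp_fun_def)
      have "(cmod (T ?g x))\<^sup>2 * sqrt (hr x) = (cmod (T ?g x))\<^sup>2 * p (\<phi> x)"
        using elim p0 by (simp add: ennreal_mult[symmetric])
      then have "sqrt (hr x) = p (\<phi> x)"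
        using pos by simp
      then show "hr x = (p (\<phi> x))\<^sup>2"
        by (metis hr_nonneg real_sqrt_pow2)
    qed
  qed
  then show ?thesis
    unfolding h_factors_through_symbol_def by (intro bexI[of _ "\<lambda>x. (p x)\<^sup>2"]) measurable
qed

end

theorem theorem1:
  fixes M :: "'a measure" and \<phi> :: "'a \<Rightarrow> 'a" and w :: "'a \<Rightarrow> complex"
  assumes "sigma_finite_measure M"
    and "\<phi> \<in> measurable M M"
    and "w \<in> borel_measurable M"
    and "absolutely_continuous M (distr (weighted_measure M w) M \<phi>)"
    and "bounded_on_L2 M (wcomp_op M \<phi> w)"
  shows "(weakly_centered M (wcomp_op M \<phi> w) \<longleftrightarrow>
          wcomp_op M \<phi> (\<lambda>x. indicator {y \<in> space M. h_deriv M \<phi> w y > 0} x * w_tilde M \<phi> w x)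
            = wcomp_op M \<phi> (w_tilde M \<phi> (w_half M \<phi> w)))
       \<and> (wcomp_op M \<phi> (\<lambda>x. indicator {y \<in> space M. h_deriv M \<phi> w y > 0} x * w_tilde M \<phi> w x)
            = wcomp_op M \<phi> (w_tilde M \<phi> (w_half M \<phi> w)) \<longleftrightarrow>
          (AE x in weighted_measure M w. h_deriv M \<phi> w x = cond_exp_w M \<phi> w (h_deriv M \<phi> w) x))"
proof -
  interpret sigma_finite_measure M by fact
  interpret bounded_weighted_composition M \<phi> w
    by unfold_locales (use assms in auto)
  show ?thesis
    using weakly_centered_imp_factors factors_imp_weakly_centered h_factors_iff_cond_exp
      wcomp_op_eq_iff_weights_eq factors_imp_weights_eq weights_eq_imp_factors
    by blast
qed

end
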